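(* Let $A,B,C$ be complex vector spaces of dimension $3$ with bases $a_1,a_2,a_3$; $b_1,b_2,b_3$; $c_1,c_2,c_3$ respectively, and let $$T := a_1 \otimes b_1 \otimes c_1 + a_2 \otimes b_2 \otimes c_2 + a_3 \otimes b_3 \otimes c_3 + \Big(\sum_{i=1}^3 a_i\Big)\otimes \Big(\sum_{i=1}^3 b_i\Big) \otimes \Big(\sum_{i=1}^3 c_i\Big) + 2 (a_1 + a_2)\otimes (b_1+b_3)\otimes (c_2+c_3).$$ Then the cactus border rank of $T$ is $5$ and the cactus border rank of $T^{\otimes 2}$ is at most $24$. Moreover, $T$ is an example of strict submultiplicativity of both cactus rank and cactus border rank: the cactus rank (respectively, cactus border rank) of $T^{\otimes 2}$ is strictly smaller than the square of the cactus rank (respectively, cactus border rank) of $T$.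
   Context: We work over $\mathbb{C}$. For a projective variety $X \subseteq \mathbb{P}^N$ and $p \in \mathbb{P}^N$, the cactus $X$-rank of $p$ is the minimum $r$ such that there is a zero-dimensional subscheme $R \subseteq X$ of length at most $r$ with $p$ in the projective linear span $\langle R \rangle$ (the smallest linear subspace of $\mathbb{P}^N$ containing $R$ as a subscheme). The $r$-th cactus variety is the Zariski closure of the set of points of cactus $X$-rank at most $r$, and the cactus border $X$-rank of $p$ is the minimum $r$ such that $p$ lies in the $r$-th cactus variety. The cactus rank and cactus border rank of a tensor in $V_1 \otimes \cdots \otimes V_k$ are those of its projective class with respect to the Segre variety of (classes of) rank-one tensors $\mathbb{P}V_1 \times \cdots \times \mathbb{P}V_k \subseteq \mathbb{P}(V_1 \otimes \cdots \otimes V_k)$. $T^{\otimes 2} = T\otimes T$ is regarded as a tensor of order $6$ in $A \otimes B \otimes C \otimes A \otimes B \otimes C$, i.e. with respect to the Segre variety of six projective planes. *)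

theory Defs
  imports "HOL-Analysis.Analysis" "HOL-Library.Function_Algebras"
begin

section \<open>Homogeneous coordinate ring\<close>

text \<open>Points of the projective space over \<open>complex ^ 'n\<close> are represented by nonzero
  vectors, and projective varieties by their sets of nonzero representatives. As the complex
  numbers are infinite, the homogeneous coordinate ring is identified with the ring of polynomial
  functions.\<close>

inductive polynomial_fun :: "(complex ^ 'n \<Rightarrow> complex) \<Rightarrow> bool" where
  const: "polynomial_fun (\<lambda>x. k)"
| coord: "polynomial_fun (\<lambda>x. x $ i)"
| add: "polynomial_fun f \<Longrightarrow> polynomial_fun g \<Longrightarrow> polynomial_fun (\<lambda>x. f x + g x)"
| mult: "polynomial_fun f \<Longrightarrow> polynomial_fun g \<Longrightarrow> polynomial_fun (\<lambda>x. f x * g x)"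

definition form :: "nat \<Rightarrow> (complex ^ 'n \<Rightarrow> complex) \<Rightarrow> bool" where
  "form d f \<longleftrightarrow> polynomial_fun f \<and> (\<forall>t x. f (t *s x) = t ^ d * f x)"

definition vanishing_ideal :: "(complex ^ 'n) set \<Rightarrow> (complex ^ 'n \<Rightarrow> complex) set" where
  "vanishing_ideal X = {f. polynomial_fun f \<and> (\<forall>x\<in>X. f x = 0)}"

definition polynomial_ideal :: "(complex ^ 'n \<Rightarrow> complex) set \<Rightarrow> bool" where
  "polynomial_ideal I \<longleftrightarrow>
     (\<forall>f\<in>I. polynomial_fun f) \<and> (\<lambda>x. 0) \<in> I \<and>
     (\<forall>f\<in>I. \<forall>g\<in>I. (\<lambda>x. f x + g x) \<in> I) \<and>
     (\<forall>f\<in>I. \<forall>h. polynomial_fun h \<longrightarrow> (\<lambda>x. h x * f x) \<in> I)"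

definition homogeneous_ideal :: "(complex ^ 'n \<Rightarrow> complex) set \<Rightarrow> bool" where
  "homogeneous_ideal I \<longleftrightarrow> polynomial_ideal I \<and>
     (\<forall>f\<in>I. \<exists>n g. (\<forall>d\<le>n. form d (g d) \<and> g d \<in> I) \<and> f = (\<lambda>x. \<Sum>d\<le>n. g d x))"

text \<open>Saturation with respect to the irrelevant ideal; its \<open>k\<close>-th power is generated by
  the forms of degree \<open>k\<close>.\<close>

definition saturated :: "(complex ^ 'n \<Rightarrow> complex) set \<Rightarrow> bool" where
  "saturated I \<longleftrightarrow>
     (\<forall>f. polynomial_fun f \<and> (\<exists>k. \<forall>g. form k g \<longrightarrow> (\<lambda>x. g x * f x) \<in> I) \<longrightarrow> f \<in> I)"


section \<open>Zero-dimensional subschemes\<close>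

global_interpretation cfun: vector_space "\<lambda>(k::complex) (f :: 'a \<Rightarrow> complex) x. k * f x"
  by unfold_locales (auto simp: fun_eq_iff algebra_simps)

definition hilbert_function :: "(complex ^ 'n \<Rightarrow> complex) set \<Rightarrow> nat \<Rightarrow> nat" where
  "hilbert_function I d = cfun.dim {f :: complex ^ 'n \<Rightarrow> complex. form d f} - cfun.dim {f \<in> I. form d f}"

text \<open>Closed subschemes of a projective space correspond bijectively, with inclusions
  reversed, to the saturated homogeneous ideals of its homogeneous coordinate ring. Such a
  subscheme is zero-dimensional (or empty) of length \<open>r\<close> iff its Hilbert polynomial is the
  constant \<open>r\<close>.\<close>

definition zero_dim_subscheme :: "(complex ^ 'n \<Rightarrow> complex) set \<Rightarrow> nat \<Rightarrow> bool" where
  "zero_dim_subscheme I r \<longleftrightarrow> homogeneous_ideal I \<and> saturated I \<and>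
     (\<forall>\<^sub>F d in sequentially. hilbert_function I d = r)"

text \<open>The span is given by its affine cone: the smallest linear subspace \<open>W\<close> whose
  projectivization contains the subscheme.\<close>

definition scheme_span :: "(complex ^ 'n \<Rightarrow> complex) set \<Rightarrow> (complex ^ 'n) set" where
  "scheme_span I = \<Inter>{W. vec.subspace W \<and> vanishing_ideal W \<subseteq> I}"


section \<open>Cactus rank and cactus border rank\<close>

text \<open>The minima are infima in \<^typ>\<open>enat\<close>, so they are infinite if no \<open>r\<close> exists.\<close>

definition cactus_rank :: "(complex ^ 'n) set \<Rightarrow> complex ^ 'n \<Rightarrow> enat" where
  "cactus_rank X p = Inf (enat ` {r. \<exists>I s. s \<le> r \<and> zero_dim_subscheme I s \<and>
     vanishing_ideal X \<subseteq> I \<and> p \<in> scheme_span I})"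

definition projective_zariski_closure :: "(complex ^ 'n) set \<Rightarrow> (complex ^ 'n) set" where
  "projective_zariski_closure P =
     {p. p \<noteq> 0 \<and> (\<forall>d f. form d f \<and> (\<forall>q\<in>P. f q = 0) \<longrightarrow> f p = 0)}"

definition cactus_variety :: "(complex ^ 'n) set \<Rightarrow> nat \<Rightarrow> (complex ^ 'n) set" where
  "cactus_variety X r = projective_zariski_closure {p. p \<noteq> 0 \<and> cactus_rank X p \<le> enat r}"

definition cactus_border_rank :: "(complex ^ 'n) set \<Rightarrow> complex ^ 'n \<Rightarrow> enat" where
  "cactus_border_rank X p = Inf (enat ` {r. p \<in> cactus_variety X r})"


section \<open>Tensors\<close>

definition tensor :: "complex ^ 'm \<Rightarrow> complex ^ 'n \<Rightarrow> complex ^ ('m \<times> 'n)"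
    (infixr "\<otimes>" 75) where
  "x \<otimes> y = (\<chi> ij. x $ fst ij * y $ snd ij)"

definition segre3 :: "(complex ^ ('k::finite \<times> 'm::finite \<times> 'n::finite)) set" where
  "segre3 = {x \<otimes> y \<otimes> z | x y z. x \<noteq> 0 \<and> y \<noteq> 0 \<and> z \<noteq> 0}"

text \<open>The Segre variety of six factors; the bracketing of the factors is immaterial and is
  chosen so that the product of two tensors of order three is an element of this space.\<close>

definition segre6 ::
    "(complex ^ (('k::finite \<times> 'm::finite \<times> 'n::finite) \<times>
       ('k'::finite \<times> 'm'::finite \<times> 'n'::finite))) set" where
  "segre6 = {(x \<otimes> y \<otimes> z) \<otimes> (x' \<otimes> y' \<otimes> z') | x y z x' y' z'.
     x \<noteq> 0 \<and> y \<noteq> 0 \<and> z \<noteq> 0 \<and> x' \<noteq> 0 \<and> y' \<noteq> 0 \<and> z' \<noteq> 0}"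

definition basis3 :: "(nat \<Rightarrow> complex ^ 3) \<Rightarrow> bool" where
  "basis3 e \<longleftrightarrow> inj_on e {1..3} \<and> vec.independent (e ` {1..3}) \<and> vec.span (e ` {1..3}) = UNIV"

end

theory Submission
  imports Defs "HOL-Computational_Algebra.Fundamental_Theorem_Algebra"
begin

text \<open>
  Write \<open>Q\<close> for the sum of the first four terms of \<open>T\<close> and \<open>Z\<close> for the product of rank one in the
  last term, so that \<open>T = Q + 2 Z\<close>.

  The upper bounds come from the fact that also \<open>Q + Z\<close> has rank at most four: in coordinates
  with respect to the three bases,
  \<open>4 (Q + Z) = (2,2,1)\<otimes>(2,1,2)\<otimes>(1,2,2) + (0,2,1)\<otimes>(0,1,0)\<otimes>(1,2,0) + (2,0,1)\<otimes>(2,1,0)\<otimes>(1,0,0) +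
  (0,0,1)\<otimes>(0,1,2)\<otimes>(1,0,2)\<close>. (Up to a change of coordinates, \<open>Q + Z\<close> is the symmetric tensor of
  a product of three independent linear forms, which is a sum of four cubes.) As
  \<open>T \<otimes> T = Q \<otimes> Q + 2 (Q + Z) \<otimes> Z + 2 Z \<otimes> (Q + Z)\<close>, the square has rank at most \<open>16 + 4 + 4 = 24\<close>.
  A point in the span of \<open>r\<close> points of a variety has cactus rank at most \<open>r\<close>
  (\<open>cactus_rank_le_card\<close>), and cactus border rank is at most cactus rank.

  The lower bound \<open>5\<close> for the cactus border rank of \<open>T\<close> comes from the Koszul flattening, the
  \<open>9 \<times> 9\<close> matrix \<open>koszul\<close> of linear forms in the coordinates of a tensor. Its determinant does not
  vanish at \<open>T\<close> (\<open>det_koszul_nonzero\<close>), so it suffices that it vanishes at all tensors \<open>p\<close> of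
  cactus rank at most four (\<open>koszul_kernel\<close>). Let \<open>p\<close> lie in the span of a subscheme of length
  \<open>s \<le> 4\<close> with saturated ideal \<open>I\<close>. There is a linear form \<open>l\<close>, the contraction with a product of
  three functionals, which is a nonzerodivisor modulo \<open>I\<close>; after division by \<open>l\<close> the generic
  tensor with coordinates in the coordinate ring of the subscheme has rank one, because \<open>I\<close>
  contains the equations of the Segre variety. A vector is annihilated by the flattening modulo
  \<open>I\<close> as soon as two combinations of its entries vanish in the coordinate ring, which has
  dimension \<open>s\<close>. These are \<open>2 s \<le> 8\<close> linear conditions on nine unknowns, so there is a nonzero
  solution. The components of the flattening at this solution are linear forms in \<open>I\<close>, hence they
  vanish at \<open>p\<close>, and the flattening of \<open>p\<close> is singular.

  The existence of \<open>l\<close> rests on \<open>zero_divisor_vanishes_at_point\<close>: a linear form that is a zero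
  divisor modulo \<open>I\<close> vanishes at some zero of \<open>I\<close>. By interpolation the zeros of \<open>I\<close> lie on
  finitely many lines through the origin, and a general product of three functionals avoids them.
\<close>

section \<open>Linear algebra\<close>

lemma (in vector_space) dim_eq_dim_add_card:
  assumes fin: "finite W" "V \<subseteq> span W" and U: "subspace U" "U \<subseteq> V"
    and E: "finite E" "E \<subseteq> V"
    and ind: "\<And>k. (\<Sum>e\<in>E. scale (k e) e) \<in> U \<Longrightarrow> \<forall>e\<in>E. k e = 0"
    and gen: "\<And>v. v \<in> V \<Longrightarrow> \<exists>k. v - (\<Sum>e\<in>E. scale (k e) e) \<in> U"
  shows "dim V = dim U + card E"
proof -
  obtain K where K: "K \<subseteq> U" "independent K" "U \<subseteq> span K" "card K = dim U"
    using basis_exists by blast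
  have finK: "finite K"
    using independent_span_bound[OF fin(1) K(2)] K(1) U(2) fin(2) by blast
  have spK: "span K \<subseteq> U"
    using K(1) U(1) by (rule span_minimal)
  have disj: "K \<inter> E = {}"
  proof (rule ccontr)
    assume "K \<inter> E \<noteq> {}"
    then obtain e where e: "e \<in> K" "e \<in> E" by blast
    have "(\<Sum>e'\<in>E. scale (if e' = e then 1 else 0) e') = (\<Sum>e'\<in>E. if e' = e then e' else 0)"
      by (rule sum.cong) auto
    also have "\<dots> = e"
      using E(1) e(2) by simp
    finally have "(\<Sum>e'\<in>E. scale (if e' = e then 1 else 0) e') \<in> U"
      using e(1) K(1) by auto
    from ind[OF this] e(2) show False by auto
  qed
  have "independent (K \<union> E)"
  proof (rule independent_if_scalars_zero)
    show "finite (K \<union> E)" using finK E(1) by simp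
    fix f x assume f: "(\<Sum>x\<in>K \<union> E. scale (f x) x) = 0" and x: "x \<in> K \<union> E"
    have split: "(\<Sum>x\<in>K. scale (f x) x) + (\<Sum>x\<in>E. scale (f x) x) = 0"
      using f sum.union_disjoint[OF finK E(1) disj] by metis
    have "(\<Sum>x\<in>K. scale (f x) x) \<in> U"
      by (intro subsetD[OF spK] span_sum span_scale span_base)
    then have "- (\<Sum>x\<in>K. scale (f x) x) \<in> U"
      using U(1) subspace_neg by blast
    then have "(\<Sum>x\<in>E. scale (f x) x) \<in> U"
      using split by (simp add: eq_neg_iff_add_eq_0 add.commute minus_unique)
    then have fE: "\<forall>e\<in>E. f e = 0" by (rule ind)
    then have "(\<Sum>x\<in>K. scale (f x) x) = 0"
      using split by simp
    then have "\<forall>x\<in>K. f x = 0"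
      using K(2) finK independent_explicit_finite_subsets by blast
    with fE x show "f x = 0" by blast
  qed
  moreover have "K \<union> E \<subseteq> V" using K(1) U(2) E(2) by blast
  moreover have "V \<subseteq> span (K \<union> E)"
  proof
    fix v assume "v \<in> V"
    then obtain k where "v - (\<Sum>e\<in>E. scale (k e) e) \<in> U" using gen by blast
    then have "v - (\<Sum>e\<in>E. scale (k e) e) \<in> span (K \<union> E)"
      using K(3) span_mono[of K "K \<union> E"] by blast
    moreover have "(\<Sum>e\<in>E. scale (k e) e) \<in> span (K \<union> E)"
      by (intro span_sum span_scale span_base) auto
    ultimately have "v - (\<Sum>e\<in>E. scale (k e) e) + (\<Sum>e\<in>E. scale (k e) e) \<in> span (K \<union> E)"
      by (rule span_add)
    then show "v \<in> span (K \<union> E)" by simp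
  qed
  ultimately have "card (K \<union> E) = dim V"
    by (intro basis_card_eq_dim)
  then show ?thesis
    using card_Un_disjoint[OF finK E(1) disj] K(4) by simp
qed

text \<open>The functionals are the coordinates, with respect to a basis of \<open>V\<close> that extends one of \<open>U\<close>,
  at the additional basis vectors. They are linear on \<open>V\<close> only, which is why linearity is built
  into the conclusion.\<close>

lemma (in vector_space) functionals_cutting_out_subspace:
  assumes fin: "finite W" "V \<subseteq> span W" and U: "subspace U" "U \<subseteq> V"
  obtains E :: "'b set" and L :: "'b \<Rightarrow> 'b \<Rightarrow> 'a" where "finite E" "card E = dim V - dim U"
    "\<And>(I :: 'i set) c h. finite I \<Longrightarrow> (\<And>i. i \<in> I \<Longrightarrow> h i \<in> V) \<Longrightarrow>
       (\<And>e. e \<in> E \<Longrightarrow> (\<Sum>i\<in>I. c i * L e (h i)) = 0) \<Longrightarrow> (\<Sum>i\<in>I. scale (c i) (h i)) \<in> U"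
proof -
  obtain K where K: "K \<subseteq> U" "independent K" "U \<subseteq> span K" "card K = dim U"
    using basis_exists by blast
  obtain B where B: "K \<subseteq> B" "B \<subseteq> V" "independent B" "V \<subseteq> span B"
    using maximal_independent_subset_extend[of K V] K U(2) by blast
  have finB: "finite B"
    using independent_span_bound[OF fin(1) B(3)] B(2) fin(2) by blast
  have cardB: "card B = dim V"
    using B by (intro basis_card_eq_dim) auto
  have "(\<Sum>i\<in>I. scale (c i) (h i)) \<in> U"
    if I: "finite I" and h: "\<And>i. i \<in> I \<Longrightarrow> h i \<in> V"
      and 0: "\<And>e. e \<in> B - K \<Longrightarrow> (\<Sum>i\<in>I. c i * representation B (h i) e) = 0"
    for I :: "'i set" and c h
  proof -
    let ?v = "\<Sum>i\<in>I. scale (c i) (h i)"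
    have hB: "h i \<in> span B" if "i \<in> I" for i
      using h[OF that] B(4) by blast
    have v: "?v \<in> span B"
      by (intro span_sum span_scale hB)
    have "representation B ?v e = (\<Sum>i\<in>I. c i * representation B (h i) e)" for e
      by (subst representation_sum[OF B(3)])
        (auto intro!: span_scale hB sum.cong simp: representation_scale[OF B(3) hB])
    then have rep0: "representation B ?v e = 0" if "e \<in> B - K" for e
      using 0[OF that] by simp
    have "(\<Sum>b\<in>B. scale (representation B ?v b) b) = ?v"
      by (rule sum_representation_eq[OF B(3) v finB order_refl])
    moreover have "(\<Sum>b\<in>B. scale (representation B ?v b) b) = (\<Sum>b\<in>K. scale (representation B ?v b) b)"
      by (rule sum.mono_neutral_right[OF finB B(1)]) (simp add: rep0)
    moreover have "\<dots> \<in> U"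
      using K(1) by (intro subspace_sum U(1) subspace_scale) auto
    ultimately show ?thesis by simp
  qed
  then have "(\<Sum>i\<in>I. scale (c i) (h i)) \<in> U"
    if "finite I" "\<And>i. i \<in> I \<Longrightarrow> h i \<in> V"
      "\<And>e. e \<in> B - K \<Longrightarrow> (\<Sum>i\<in>I. c i * representation B (h i) e) = 0"
    for I :: "'i set" and c h
    using that by blast
  moreover have "card (B - K) = dim V - dim U"
    using card_Diff_subset[OF finite_subset[OF B(1) finB] B(1)] cardB K(4) by simp
  ultimately show thesis
    using finB by (intro that[of "B - K" "\<lambda>e f. representation B f e"]) auto
qed

lemma nontrivial_solution:
  fixes m :: "'q \<Rightarrow> 'j \<Rightarrow> 'a::field"
  assumes "finite Q" and "finite J" and "card Q < card J"
  shows "\<exists>c. (\<exists>j\<in>J. c j \<noteq> 0) \<and> (\<forall>q\<in>Q. (\<Sum>j\<in>J. c j * m q j) = 0)"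
  using assms
proof (induction Q arbitrary: J m rule: finite_induct)
  case empty
  then have "J \<noteq> {}" by auto
  then show ?case by (intro exI[of _ "\<lambda>_. 1"]) auto
next
  case (insert q Q)
  have less: "card Q < card J" using insert by simp
  show ?case
  proof (cases "\<forall>j\<in>J. m q j = 0")
    case True
    obtain c where "\<exists>j\<in>J. c j \<noteq> 0" "\<forall>q\<in>Q. (\<Sum>j\<in>J. c j * m q j) = 0"
      using insert.IH[OF insert.prems(1) less] by blast
    with True show ?thesis by (intro exI[of _ c]) auto
  next
    case False
    then obtain j0 where j0: "j0 \<in> J" "m q j0 \<noteq> 0" by blast
    let ?J = "J - {j0}"
    let ?m = "\<lambda>p j. m p j - m p j0 * m q j / m q j0"
    have "card Q < card ?J"
      using insert j0 by simp
    then obtain c where c: "\<exists>j\<in>?J. c j \<noteq> 0" "\<forall>p\<in>Q. (\<Sum>j\<in>?J. c j * ?m p j) = 0"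
      using insert.IH[of ?J ?m] insert.prems(1) by blast
    let ?s = "\<Sum>j\<in>?J. c j * m q j"
    let ?c = "c(j0 := - ?s / m q j0)"
    have sum_eq: "(\<Sum>j\<in>J. ?c j * m p j) = - ?s / m q j0 * m p j0 + (\<Sum>j\<in>?J. c j * m p j)" for p
    proof -
      have "(\<Sum>j\<in>J. ?c j * m p j) = ?c j0 * m p j0 + (\<Sum>j\<in>?J. ?c j * m p j)"
        by (rule sum.remove[OF insert.prems(1) j0(1)])
      also have "(\<Sum>j\<in>?J. ?c j * m p j) = (\<Sum>j\<in>?J. c j * m p j)"
        by (rule sum.cong) auto
      finally show ?thesis by simp
    qed
    have "(\<Sum>j\<in>J. ?c j * m q j) = 0"
      unfolding sum_eq using j0(2) by simp
    moreover have "(\<Sum>j\<in>J. ?c j * m p j) = 0" if "p \<in> Q" for p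
    proof -
      have "0 = (\<Sum>j\<in>?J. c j * ?m p j)" using c(2) that by simp
      also have "\<dots> = (\<Sum>j\<in>?J. c j * m p j - m p j0 / m q j0 * (c j * m q j))"
        by (rule sum.cong) (auto simp: field_simps)
      also have "\<dots> = (\<Sum>j\<in>?J. c j * m p j) - m p j0 / m q j0 * ?s"
        by (simp only: sum_subtractf sum_distrib_left)
      finally show ?thesis unfolding sum_eq by (simp add: field_simps)
    qed
    moreover have "\<exists>j\<in>J. ?c j \<noteq> 0" using c(1) by auto
    ultimately show ?thesis by (intro exI[of _ ?c]) auto
  qed
qed

section \<open>Polynomial functions and forms\<close>

lemma polynomial_fun_cmult: "polynomial_fun f \<Longrightarrow> polynomial_fun (\<lambda>x. k * f x)"
  by (rule polynomial_fun.mult[OF polynomial_fun.const])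

lemma polynomial_fun_diff:
  assumes "polynomial_fun f" and "polynomial_fun g"
  shows "polynomial_fun (\<lambda>x. f x - g x)"
  using polynomial_fun.add[OF assms(1) polynomial_fun_cmult[OF assms(2), of "-1"]] by simp

lemma polynomial_fun_sum:
  "(\<And>i. i \<in> S \<Longrightarrow> polynomial_fun (f i)) \<Longrightarrow> polynomial_fun (\<lambda>x. \<Sum>i\<in>S. f i x)"
  by (induction S rule: infinite_finite_induct) (auto intro: polynomial_fun.intros)

lemma polynomial_fun_prod:
  "(\<And>i. i \<in> S \<Longrightarrow> polynomial_fun (f i)) \<Longrightarrow> polynomial_fun (\<lambda>x. \<Prod>i\<in>S. f i x)"
  by (induction S rule: infinite_finite_induct) (auto intro: polynomial_fun.intros)

lemma polynomial_fun_power: "polynomial_fun f \<Longrightarrow> polynomial_fun (\<lambda>x. f x ^ k)"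
  by (induction k) (auto intro: polynomial_fun.intros)

lemmas polynomial_fun_intros = polynomial_fun.const polynomial_fun.coord polynomial_fun.add
  polynomial_fun.mult polynomial_fun_diff polynomial_fun_sum polynomial_fun_prod
  polynomial_fun_power

lemma form_imp_polynomial_fun: "form d f \<Longrightarrow> polynomial_fun f"
  by (simp add: form_def)

lemma form_scale: "form d f \<Longrightarrow> f (t *s x) = t ^ d * f x"
  by (simp add: form_def)

lemma form_zero: "form d (\<lambda>x. 0)"
  by (simp add: form_def polynomial_fun.const)

lemma form_one: "form 0 (\<lambda>x. 1)"
  by (simp add: form_def polynomial_fun.const)

lemma form_coord: "form 1 (\<lambda>x. x $ i)"
  by (simp add: form_def polynomial_fun.coord)

lemma form_add: "form d f \<Longrightarrow> form d g \<Longrightarrow> form d (\<lambda>x. f x + g x)"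
  by (simp add: form_def polynomial_fun.add distrib_left)

lemma form_diff: "form d f \<Longrightarrow> form d g \<Longrightarrow> form d (\<lambda>x. f x - g x)"
  by (simp add: form_def polynomial_fun_diff right_diff_distrib)

lemma form_cmult: "form d f \<Longrightarrow> form d (\<lambda>x. k * f x)"
  by (simp add: form_def polynomial_fun_cmult)

lemma form_sum: "(\<And>i. i \<in> S \<Longrightarrow> form d (f i)) \<Longrightarrow> form d (\<lambda>x. \<Sum>i\<in>S. f i x)"
  by (induction S rule: infinite_finite_induct) (auto intro: form_zero form_add)

lemma form_mult: "form d f \<Longrightarrow> form e g \<Longrightarrow> form (d + e) (\<lambda>x. f x * g x)"
  by (simp add: form_def polynomial_fun.mult power_add)

lemma form_prod:
  "(\<And>i. i \<in> S \<Longrightarrow> form (d i) (f i)) \<Longrightarrow> form (sum d S) (\<lambda>x. \<Prod>i\<in>S. f i x)"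
  by (induction S rule: infinite_finite_induct) (auto intro: form_one form_mult)

lemma form_power: "form d f \<Longrightarrow> form (d * k) (\<lambda>x. f x ^ k)"
  by (simp add: form_def polynomial_fun_power power_mult power_mult_distrib)

lemma form_1_power: "form 1 f \<Longrightarrow> form k (\<lambda>x. f x ^ k)"
  using form_power[of 1 f k] by simp

text \<open>This provides the dual linear forms of an independent set, and linear forms that distinguish
  points on different lines.\<close>

lemma separating_functional:
  fixes W :: "(complex ^ 'n) set"
  assumes "vec.subspace W" and "b \<notin> W"
  obtains l where "form 1 l" "\<And>w. w \<in> W \<Longrightarrow> l w = 0" "l b = 1"
proof -
  obtain B where B: "B \<subseteq> W" "vec.independent B" "W \<subseteq> vec.span B"
    using vec.maximal_independent_subset by blast
  have sp: "vec.span B = W"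
    using B vec.span_minimal[OF B(1) assms(1)] by blast
  have "vec.independent (insert b B)"
    using B(2) assms(2) sp vec.independent_insertI by blast
  then obtain g :: "complex ^ 'n \<Rightarrow> complex ^ 1"
    where g: "Vector_Spaces.linear (*s) (*s) g"
      "\<forall>x\<in>insert b B. g x = (if x = b then 1 else 0)"
    using vec.linear_independent_extend[of "insert b B" "\<lambda>x. if x = b then 1 else 0"] by blast
  interpret g: Vector_Spaces.linear "(*s)" "(*s)" g by (rule g(1))
  have g0: "g w = 0" if "w \<in> W" for w
  proof -
    have "b \<notin> B" using assms(2) B(1) by blast
    then have "g x = 0" if "x \<in> B" for x using g(2) that by auto
    then show ?thesis
      using that sp g.eq_0_on_span[of B w] by blast
  qed
  let ?l = "\<lambda>x. g x $ 1"
  have lin: "?l x = (\<Sum>i\<in>UNIV. matrix g $ 1 $ i * x $ i)" for x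
    unfolding matrix_works[OF g(1), of x, symmetric] by (simp add: matrix_vector_mult_def)
  have "form 1 ?l"
    unfolding lin by (intro form_sum form_cmult form_coord)
  then show thesis
    by (rule that) (auto simp: g0 g(2))
qed


lemma sum_fun_apply: "(\<Sum>i\<in>S. f i) x = (\<Sum>i\<in>S. f i x)"
  by (induction S rule: infinite_finite_induct) auto

definition monom_fun :: "('n \<Rightarrow> nat) \<Rightarrow> complex ^ 'n \<Rightarrow> complex" where
  "monom_fun e = (\<lambda>x. \<Prod>i\<in>UNIV. x $ i ^ e i)"

lemma form_monom_fun: "form (sum e UNIV) (monom_fun e)"
  unfolding monom_fun_def by (rule form_prod) (rule form_1_power[OF form_coord])

lemma monom_fun_mult: "(\<lambda>x. monom_fun e x * monom_fun e' x) = monom_fun (\<lambda>i. e i + e' i)"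
  by (simp add: monom_fun_def power_add prod.distrib)

lemma finite_exponents: "finite {e :: 'n::finite \<Rightarrow> nat. sum e UNIV = d}"
proof (rule finite_subset)
  show "{e :: 'n \<Rightarrow> nat. sum e UNIV = d} \<subseteq> Pi\<^sub>E UNIV (\<lambda>_. {..d})"
  proof
    fix e :: "'n \<Rightarrow> nat" assume "e \<in> {e. sum e UNIV = d}"
    then have "e i \<le> d" for i using member_le_sum[of i UNIV e] by simp
    then show "e \<in> Pi\<^sub>E UNIV (\<lambda>_. {..d})" by (simp add: PiE_def Pi_def)
  qed
  show "finite (Pi\<^sub>E (UNIV :: 'n set) (\<lambda>_. {..d}))"
    by (rule finite_PiE) auto
qed

lemma cfun_span_mult:
  assumes "\<And>u v. u \<in> A \<Longrightarrow> v \<in> A \<Longrightarrow> (\<lambda>x. u x * v x) \<in> cfun.span A"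
    and "f \<in> cfun.span A" and "g \<in> cfun.span A"
  shows "(\<lambda>x. f x * g x) \<in> cfun.span A"
proof -
  have *: "(\<lambda>x. u x * g x) \<in> cfun.span A" if u: "u \<in> A" for u
    using assms(3)
  proof (induction rule: cfun.span_induct_alt)
    case base
    then show ?case using cfun.span_zero[of A] by (simp add: zero_fun_def)
  next
    case (step c v y)
    have "(\<lambda>x. c * (u x * v x)) + (\<lambda>x. u x * y x) \<in> cfun.span A"
      using assms(1)[OF u step(1)] step(2) by (intro cfun.span_add cfun.span_scale)
    also have "(\<lambda>x. c * (u x * v x)) + (\<lambda>x. u x * y x) = (\<lambda>x. u x * ((\<lambda>x. c * v x) + y) x)"
      by (auto simp: fun_eq_iff algebra_simps)
    finally show ?case .
  qed
  show ?thesis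
    using assms(2)
  proof (induction rule: cfun.span_induct_alt)
    case base
    then show ?case using cfun.span_zero[of A] by (simp add: zero_fun_def)
  next
    case (step c v y)
    have "(\<lambda>x. c * (v x * g x)) + (\<lambda>x. y x * g x) \<in> cfun.span A"
      using *[OF step(1)] step(2) by (intro cfun.span_add cfun.span_scale)
    also have "(\<lambda>x. c * (v x * g x)) + (\<lambda>x. y x * g x) = (\<lambda>x. ((\<lambda>x. c * v x) + y) x * g x)"
      by (auto simp: fun_eq_iff algebra_simps)
    finally show ?case .
  qed
qed

lemma polynomial_fun_in_span: "polynomial_fun f \<Longrightarrow> f \<in> cfun.span (range monom_fun)"
proof (induction rule: polynomial_fun.induct)
  case (const k)
  have "(\<lambda>x. k * monom_fun (\<lambda>_. 0) x) \<in> cfun.span (range monom_fun)"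
    by (intro cfun.span_scale cfun.span_base rangeI)
  then show ?case by (simp add: monom_fun_def)
next
  case (coord i)
  have "monom_fun (\<lambda>j. if j = i then 1 else 0) x = x $ i" for x :: "complex ^ 'a"
  proof -
    have "monom_fun (\<lambda>j. if j = i then 1 else 0) x = (\<Prod>j\<in>UNIV. if j = i then x $ j else 1)"
      unfolding monom_fun_def by (rule prod.cong) auto
    then show ?thesis by simp
  qed
  then have "(\<lambda>x :: complex ^ 'a. x $ i) = monom_fun (\<lambda>j. if j = i then 1 else 0)"
    by (auto simp: fun_eq_iff)
  then show ?case by (simp add: cfun.span_base)
next
  case (add f g)
  then have "f + g \<in> cfun.span (range monom_fun)" by (intro cfun.span_add)
  then show ?case by (simp add: plus_fun_def)
next
  case (mult f g)
  show ?case
    by (rule cfun_span_mult[OF _ mult.IH]) (auto simp: monom_fun_mult cfun.span_base)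
qed

text \<open>Besides the homogeneous components, the spanning sets are recorded, as they show that the
  forms of each degree have finite dimension.\<close>

lemma polynomial_fun_decomposition:
  assumes "polynomial_fun f"
  obtains n g where "f = (\<lambda>x. \<Sum>d\<le>n. g d x)" "\<And>d. form d (g d)"
    "\<And>d. g d \<in> cfun.span (monom_fun ` {e. sum e UNIV = d})"
proof -
  obtain S r where S: "finite S" "S \<subseteq> range monom_fun" "f = (\<Sum>m\<in>S. (\<lambda>x. r m * m x))"
    using polynomial_fun_in_span[OF assms] unfolding cfun.span_explicit by blast
  from S(2) have "\<forall>m\<in>S. \<exists>e. m = monom_fun e" by blast
  then obtain ex where ex: "\<And>m. m \<in> S \<Longrightarrow> m = monom_fun (ex m)" by metis
  define dg where "dg m = sum (ex m) UNIV" for m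
  define n where "n = Max (insert 0 (dg ` S))"
  define g where "g d = (\<lambda>x. \<Sum>m\<in>{m\<in>S. dg m = d}. r m * m x)" for d
  have n: "dg m \<le> n" if "m \<in> S" for m
    unfolding n_def using S(1) that by (intro Max_ge) auto
  have "f x = (\<Sum>d\<le>n. g d x)" for x
  proof -
    have "f x = (\<Sum>m\<in>S. r m * m x)"
      unfolding S(3) by (simp add: sum_fun_apply)
    also have "\<dots> = (\<Sum>d\<le>n. \<Sum>m\<in>{m\<in>S. dg m = d}. r m * m x)"
      by (rule sum.group[symmetric]) (use S(1) n in auto)
    finally show ?thesis by (simp add: g_def)
  qed
  moreover have "form d (g d)" for d
    unfolding g_def
  proof (intro form_sum form_cmult)
    fix m assume m: "m \<in> {m\<in>S. dg m = d}"
    then have "form (dg m) m"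
      using form_monom_fun[of "ex m"] ex[of m] by (simp add: dg_def)
    then show "form d m" using m by simp
  qed
  moreover have "g d \<in> cfun.span (monom_fun ` {e. sum e UNIV = d})" for d
  proof -
    have "m \<in> monom_fun ` {e. sum e UNIV = d}" if "m \<in> {m\<in>S. dg m = d}" for m
      using that ex[of m] by (auto simp: dg_def)
    then have "(\<Sum>m\<in>{m\<in>S. dg m = d}. (\<lambda>x. r m * m x)) \<in> cfun.span (monom_fun ` {e. sum e UNIV = d})"
      by (intro cfun.span_sum cfun.span_scale cfun.span_base)
    moreover have "(\<Sum>m\<in>{m\<in>S. dg m = d}. (\<lambda>x. r m * m x)) = g d"
      unfolding g_def by (auto simp: fun_eq_iff sum_fun_apply)
    ultimately show ?thesis by simp
  qed
  ultimately show thesis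
    by (intro that[of g n]) auto
qed

text \<open>Both sides of \<open>f (t x) = t\<^sup>d f x\<close> are polynomials in \<open>t\<close>, so their coefficients agree.\<close>

lemma homogeneous_component_eq:
  assumes "form d f" and "f = (\<lambda>x. \<Sum>d\<le>n. g d x)" and "\<And>d. form d (g d)"
  shows "f = (if d \<le> n then g d else (\<lambda>x. 0))"
proof
  fix x
  let ?N = "max d n"
  have "(\<Sum>e\<le>?N. (if e = d then f x else 0) * t ^ e)
      = (\<Sum>e\<le>?N. (if e \<le> n then g e x else 0) * t ^ e)" for t
  proof -
    have "(\<Sum>e\<le>?N. (if e = d then f x else 0) * t ^ e) = (\<Sum>e\<le>?N. if e = d then f x * t ^ e else 0)"
      by (rule sum.cong) auto
    also have "\<dots> = t ^ d * f x" by simp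
    also have "\<dots> = f (t *s x)" using form_scale[OF assms(1)] by simp
    also have "\<dots> = (\<Sum>e\<le>n. g e (t *s x))" by (subst assms(2)) simp
    also have "\<dots> = (\<Sum>e\<le>n. g e x * t ^ e)"
      by (simp add: form_scale[OF assms(3)] mult.commute)
    also have "\<dots> = (\<Sum>e\<le>?N. if e \<in> {..n} then g e x * t ^ e else 0)"
      by (subst sum.inter_restrict[symmetric]) (auto intro!: sum.cong)
    also have "\<dots> = (\<Sum>e\<le>?N. (if e \<le> n then g e x else 0) * t ^ e)"
      by (rule sum.cong) auto
    finally show ?thesis .
  qed
  then have "\<forall>e\<le>?N. (if e = d then f x else 0) = (if e \<le> n then g e x else 0)"
    using iffD1[OF polyfun_eq_coeffs[of "\<lambda>e. if e = d then f x else 0" ?N "\<lambda>e. if e \<le> n then g e x else 0"]]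
    by simp
  then show "f x = (if d \<le> n then g d else (\<lambda>x. 0)) x"
    by (auto dest: spec[of _ d])
qed

lemma form_in_span:
  assumes "form d f"
  shows "f \<in> cfun.span (monom_fun ` {e. sum e UNIV = d})"
proof -
  obtain n g where g: "f = (\<lambda>x. \<Sum>d\<le>n. g d x)" "\<And>d. form d (g d)"
    "\<And>d. g d \<in> cfun.span (monom_fun ` {e. sum e UNIV = d})"
    using polynomial_fun_decomposition[OF form_imp_polynomial_fun[OF assms]] by blast
  show ?thesis
    unfolding homogeneous_component_eq[OF assms g(1,2)]
    using g(3) cfun.span_zero by (auto simp: zero_fun_def)
qed

lemma sum_fun_eq: "(\<Sum>i\<in>S. f i) = (\<lambda>x. \<Sum>i\<in>S. f i x)"
  by (simp add: fun_eq_iff sum_fun_apply)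

section \<open>Ideals and Hilbert functions\<close>

lemma ideal_zero: "polynomial_ideal I \<Longrightarrow> (\<lambda>x. 0) \<in> I"
  by (simp add: polynomial_ideal_def)

lemma ideal_add: "polynomial_ideal I \<Longrightarrow> f \<in> I \<Longrightarrow> g \<in> I \<Longrightarrow> (\<lambda>x. f x + g x) \<in> I"
  by (simp add: polynomial_ideal_def)

lemma ideal_mult: "polynomial_ideal I \<Longrightarrow> f \<in> I \<Longrightarrow> polynomial_fun h \<Longrightarrow> (\<lambda>x. h x * f x) \<in> I"
  by (simp add: polynomial_ideal_def)

lemma ideal_cmult: "polynomial_ideal I \<Longrightarrow> f \<in> I \<Longrightarrow> (\<lambda>x. k * f x) \<in> I"
  by (rule ideal_mult) (auto intro: polynomial_fun.const)

lemma ideal_diff: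
  assumes "polynomial_ideal I" and "f \<in> I" and "g \<in> I"
  shows "(\<lambda>x. f x - g x) \<in> I"
  using ideal_add[OF assms(1,2) ideal_cmult[OF assms(1,3), of "-1"]] by simp

lemma subspace_forms_in_ideal:
  "polynomial_ideal I \<Longrightarrow> cfun.subspace {f \<in> I. form d f}"
  unfolding cfun.subspace_def zero_fun_def plus_fun_def
  by (auto intro: form_zero form_add form_cmult ideal_zero ideal_add ideal_cmult)

lemma forms_finitely_spanned:
  "finite (monom_fun ` {e. sum e UNIV = d})"
  "{f. form d f} \<subseteq> cfun.span (monom_fun ` {e. sum e UNIV = d})"
  using finite_exponents form_in_span by auto

text \<open>Forms of degree \<open>d\<close> lie in \<open>I\<close> iff \<open>s\<close> linear functionals vanish on them. Everything that is
  used about the length of a subscheme is this count of linear conditions.\<close>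

lemma nontrivial_combination_in_ideal:
  fixes h :: "'r \<Rightarrow> 'j \<Rightarrow> complex ^ 'n \<Rightarrow> complex"
  assumes I: "polynomial_ideal I" and s: "hilbert_function I d = s"
    and fin: "finite R" "finite J"
    and h: "\<And>r j. r \<in> R \<Longrightarrow> j \<in> J \<Longrightarrow> form d (h r j)"
    and less: "card R * s < card J"
  obtains c where "\<exists>j\<in>J. c j \<noteq> 0" "\<And>r. r \<in> R \<Longrightarrow> (\<lambda>x. \<Sum>j\<in>J. c j * h r j x) \<in> I"
proof -
  have sub: "{f \<in> I. form d f} \<subseteq> {f. form d f}" by blast
  show thesis
  proof (rule cfun.functionals_cutting_out_subspace[where 'i = 'j,
        OF forms_finitely_spanned subspace_forms_in_ideal[OF I, of d] sub])
    fix E :: "(complex ^ 'n \<Rightarrow> complex) set" and L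
    assume E: "finite E" "card E = cfun.dim {f :: complex ^ 'n \<Rightarrow> complex. form d f} - cfun.dim {f \<in> I. form d f}"
      and L: "\<And>(S :: 'j set) c h. finite S \<Longrightarrow> (\<And>i. i \<in> S \<Longrightarrow> h i \<in> {f. form d f}) \<Longrightarrow>
         (\<And>e. e \<in> E \<Longrightarrow> (\<Sum>i\<in>S. c i * L e (h i)) = 0) \<Longrightarrow>
         (\<Sum>i\<in>S. (\<lambda>x. c i * h i x)) \<in> {f \<in> I. form d f}"
    have "card (R \<times> E) < card J"
      using less E(2) s by (simp add: card_cartesian_product hilbert_function_def)
    then obtain c where c: "\<exists>j\<in>J. c j \<noteq> 0"
      "\<forall>q\<in>R \<times> E. (\<Sum>j\<in>J. c j * L (snd q) (h (fst q) j)) = 0"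
      using nontrivial_solution[of "R \<times> E" J "\<lambda>q j. L (snd q) (h (fst q) j)"] fin E(1) by auto
    have "(\<lambda>x. \<Sum>j\<in>J. c j * h r j x) \<in> I" if r: "r \<in> R" for r
    proof -
      have "(\<Sum>i\<in>J. c i * L e (h r i)) = 0" if "e \<in> E" for e
        using bspec[OF c(2), of "(r, e)"] r that by simp
      then have "(\<Sum>j\<in>J. (\<lambda>x. c j * h r j x)) \<in> {f \<in> I. form d f}"
        by (intro L fin) (simp_all add: h r)
      then show ?thesis
        by (simp add: sum_fun_eq)
    qed
    with c(1) show thesis by (rule that)
  qed
qed

text \<open>A substitution that is the identity on coordinates modulo \<open>J\<close> is the identity on all polynomials
  modulo \<open>J\<close>. It is applied to the projection onto a hyperplane and to the projection onto a line.\<close>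

lemma substitution_congruence:
  assumes J: "polynomial_ideal J"
    and \<sigma>: "\<And>i. polynomial_fun (\<lambda>x. \<sigma> x $ i)" "\<And>i. (\<lambda>x. x $ i - \<sigma> x $ i) \<in> J"
    and f: "polynomial_fun f"
  shows "polynomial_fun (\<lambda>x. f (\<sigma> x)) \<and> (\<lambda>x. f x - f (\<sigma> x)) \<in> J"
  using f
proof (induction rule: polynomial_fun.induct)
  case (const k)
  then show ?case using ideal_zero[OF J] by (simp add: polynomial_fun.const)
next
  case (coord i)
  then show ?case using \<sigma> by simp
next
  case (add f g)
  then have "(\<lambda>x. (f x - f (\<sigma> x)) + (g x - g (\<sigma> x))) \<in> J"
    by (intro ideal_add J) auto
  with add show ?case by (simp add: polynomial_fun.add algebra_simps)
next
  case (mult f g)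
  then have "(\<lambda>x. f x * (g x - g (\<sigma> x)) + g (\<sigma> x) * (f x - f (\<sigma> x))) \<in> J"
    by (intro ideal_add ideal_mult J) auto
  with mult show ?case by (simp add: polynomial_fun.mult algebra_simps)
qed

section \<open>Linear spans of subschemes\<close>

lemma form_1_additive:
  assumes "form 1 l"
  shows "l (x + y) = l x + l y"
proof -
  have "l \<in> cfun.span (monom_fun ` {e. sum e UNIV = 1})"
    using assms by (rule form_in_span)
  then show ?thesis
  proof (induction rule: cfun.span_induct_alt)
    case base
    then show ?case by simp
  next
    case (step k m f)
    then obtain e where e: "m = monom_fun e" "sum e UNIV = (1::nat)" by blast
    then obtain i where i: "e i = 1" "\<And>j. j \<noteq> i \<Longrightarrow> e j = 0"
      using sum_eq_1_iff[of UNIV e] by auto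
    have "monom_fun e z = z $ i" for z
    proof -
      have "monom_fun e z = (\<Prod>j\<in>UNIV. if j = i then z $ j else 1)"
        unfolding monom_fun_def by (rule prod.cong) (auto simp: i)
      then show ?thesis by simp
    qed
    then show ?case using step e(1) by (simp add: algebra_simps)
  qed
qed

text \<open>The projection \<open>x - l x u\<close> onto the hyperplane \<open>l = 0\<close> is congruent to \<open>x\<close> modulo \<open>I\<close>, so every
  polynomial that vanishes on the hyperplane is in \<open>I\<close>. Thus the hyperplane is one of the subspaces
  whose intersection is the span.\<close>

lemma linear_form_vanishes_on_scheme_span:
  assumes I: "polynomial_ideal I" and l: "form 1 l" "l \<in> I" and p: "p \<in> scheme_span I"
  shows "l p = 0"
proof (rule ccontr)
  assume lp: "l p \<noteq> 0"
  define u where "u = (1 / l p) *s p"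
  have u: "l u = 1" using lp form_scale[OF l(1)] by (simp add: u_def)
  define W where "W = {x. l x = 0}"
  have "l 0 = 0" using form_scale[OF l(1), of 0 0] by simp
  then have W: "vec.subspace W"
    unfolding vec.subspace_def W_def by (simp add: form_1_additive[OF l(1)] form_scale[OF l(1)])
  define \<sigma> where "\<sigma> x = x - l x *s u" for x
  have \<sigma>W: "\<sigma> x \<in> W" for x
  proof -
    have "l (x + (- l x) *s u) = 0"
      by (simp only: form_1_additive[OF l(1)] form_scale[OF l(1)] u) simp
    moreover have "\<sigma> x = x + (- l x) *s u"
      by (simp add: \<sigma>_def vec_eq_iff)
    ultimately show ?thesis by (simp add: W_def)
  qed
  have "f \<in> I" if f: "f \<in> vanishing_ideal W" for f
  proof -
    have "(\<lambda>x. f x - f (\<sigma> x)) \<in> I"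
    proof (rule conjunct2[OF substitution_congruence[OF I]])
      show "polynomial_fun (\<lambda>x. \<sigma> x $ i)" for i
        using form_imp_polynomial_fun[OF l(1)] by (auto simp: \<sigma>_def intro!: polynomial_fun_intros)
      show "(\<lambda>x. x $ i - \<sigma> x $ i) \<in> I" for i
        using ideal_cmult[OF I l(2), of "u $ i"] by (simp add: \<sigma>_def mult.commute)
      show "polynomial_fun f" using f by (simp add: vanishing_ideal_def)
    qed
    moreover have "f (\<sigma> x) = 0" for x
      using f \<sigma>W by (simp add: vanishing_ideal_def)
    ultimately show ?thesis by simp
  qed
  then have "p \<in> W"
    using p W unfolding scheme_span_def by blast
  with lp show False by (simp add: W_def)
qed

text \<open>A linear form that vanishes on \<open>W\<close>, but not at a point of \<open>B\<close>, cannot be in \<open>I\<close>.\<close>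

lemma points_in_scheme_span:
  assumes "vanishing_ideal B \<supseteq> I"
  shows "vec.span B \<subseteq> scheme_span I"
proof -
  have "B \<subseteq> W" if W: "vec.subspace W" "vanishing_ideal W \<subseteq> I" for W
  proof
    fix b assume b: "b \<in> B"
    show "b \<in> W"
    proof (rule ccontr)
      assume "b \<notin> W"
      then obtain l where l: "form 1 l" "\<And>w. w \<in> W \<Longrightarrow> l w = 0" "l b = 1"
        using separating_functional[OF W(1)] by blast
      have "l \<in> I"
        using W(2) form_imp_polynomial_fun[OF l(1)] l(2) by (auto simp: vanishing_ideal_def)
      then show False using assms b l(3) by (auto simp: vanishing_ideal_def)
    qed
  qed
  then have "vec.span B \<subseteq> W" if "vec.subspace W" "vanishing_ideal W \<subseteq> I" for W
    using that vec.span_minimal by blast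
  then show ?thesis
    unfolding scheme_span_def by blast
qed

section \<open>Reduced subschemes and the upper bounds\<close>

text \<open>The ideal of the punctured lines through the points contains the homogeneous components of its
  elements, as a polynomial in \<open>t\<close> with infinitely many zeros vanishes. Powers of the linear forms
  dual to \<open>B\<close> interpolate at \<open>B\<close> in each positive degree, so the Hilbert
  function is \<open>card B\<close> from degree one on.\<close>

lemma zero_dim_subscheme_points:
  fixes B :: "(complex ^ 'n) set"
  assumes fin: "finite B" and ind: "vec.independent B"
  defines "I \<equiv> vanishing_ideal {t *s b | t b. b \<in> B \<and> t \<noteq> 0}"
  shows "zero_dim_subscheme I (card B)"
proof -
  have in_I: "f \<in> I \<longleftrightarrow> polynomial_fun f \<and> (\<forall>b\<in>B. \<forall>t. t \<noteq> 0 \<longrightarrow> f (t *s b) = 0)" for f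
    unfolding I_def vanishing_ideal_def by blast
  have I: "polynomial_ideal I"
    unfolding polynomial_ideal_def Ball_def in_I by (auto intro: polynomial_fun_intros)
  have form_in_I: "f \<in> I \<longleftrightarrow> (\<forall>b\<in>B. f b = 0)" if "form d f" for f d
    unfolding in_I using that form_imp_polynomial_fun[OF that]
    by (auto simp: form_scale dest: spec[of _ 1])
  have hom: "homogeneous_ideal I"
    unfolding homogeneous_ideal_def
  proof (intro conjI I ballI)
    fix f assume f: "f \<in> I"
    then obtain n g where g: "f = (\<lambda>x. \<Sum>d\<le>n. g d x)" "\<And>d. form d (g d)"
      using polynomial_fun_decomposition[of f] in_I by blast
    have "g d b = 0" if b: "b \<in> B" and d: "d \<le> n" for b d
    proof (rule ccontr)
      assume "g d b \<noteq> 0"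
      then have "finite {t. (\<Sum>d\<le>n. g d b * t ^ d) = 0}"
        using polyfun_finite_roots[of "\<lambda>d. g d b" n] d by blast
      moreover have "(\<Sum>d\<le>n. g d b * t ^ d) = 0" if "t \<noteq> 0" for t
      proof -
        have "(\<Sum>d\<le>n. g d b * t ^ d) = f (t *s b)"
          by (simp add: g(1) form_scale[OF g(2)] mult.commute)
        with f b that show ?thesis by (simp add: in_I)
      qed
      then have "UNIV - {0} \<subseteq> {t. (\<Sum>d\<le>n. g d b * t ^ d) = 0}" by blast
      ultimately have "finite (UNIV - {0 :: complex})" by (rule finite_subset[rotated])
      then show False by (simp add: infinite_UNIV_char_0)
    qed
    then have "g d \<in> I" if "d \<le> n" for d
      using that form_in_I[OF g(2)] by blast
    with g show "\<exists>n g. (\<forall>d\<le>n. form d (g d) \<and> g d \<in> I) \<and> f = (\<lambda>x. \<Sum>d\<le>n. g d x)"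
      by blast
  qed
  have "saturated I"
    unfolding saturated_def
  proof (intro allI impI, elim conjE exE)
    fix f k assume f: "polynomial_fun f" and k: "\<forall>g. form k g \<longrightarrow> (\<lambda>x. g x * f x) \<in> I"
    have "f (t *s b) = 0" if b: "b \<in> B" and t: "t \<noteq> 0" for b t
    proof -
      have "b \<noteq> 0" using ind b vec.dependent_zero by blast
      then obtain i where i: "b $ i \<noteq> 0" by (auto simp: vec_eq_iff)
      have "(\<lambda>x. x $ i ^ k * f x) \<in> I"
        using k form_1_power[OF form_coord] by blast
      then have "(t *s b) $ i ^ k * f (t *s b) = 0"
        using b t unfolding in_I by blast
      with i t show ?thesis by simp
    qed
    with f show "f \<in> I" by (simp add: in_I)
  qed
  moreover have "hilbert_function I d = card B" if d: "d \<ge> 1" for d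
  proof -
    have "\<exists>l. form 1 l \<and> (\<forall>b'\<in>B. l b' = (if b' = b then 1 else 0))" if b: "b \<in> B" for b
    proof -
      have "b \<notin> vec.span (B - {b})" using ind b vec.dependent_def by blast
      then obtain l where "form 1 l" "\<And>w. w \<in> vec.span (B - {b}) \<Longrightarrow> l w = 0" "l b = 1"
        using separating_functional[OF vec.subspace_span] by blast
      then show ?thesis by (intro exI[of _ l]) (auto intro: vec.span_base)
    qed
    then obtain l where l: "\<And>b. b \<in> B \<Longrightarrow> form 1 (l b)"
      "\<And>b b'. b \<in> B \<Longrightarrow> b' \<in> B \<Longrightarrow> l b b' = (if b' = b then 1 else 0)"
      by metis
    define q where "q b = (\<lambda>x. l b x ^ d)" for b
    have q: "form d (q b)" if "b \<in> B" for b
      unfolding q_def by (rule form_1_power[OF l(1)[OF that]])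
    have qv: "q b b' = (if b' = b then 1 else 0)" if "b \<in> B" "b' \<in> B" for b b'
      unfolding q_def using l(2)[OF that] d by simp
    have inj: "inj_on q B"
      by (rule inj_onI) (metis qv zero_neq_one)
    have at_point: "(\<Sum>e\<in>q ` B. (\<lambda>x. k e * e x)) b = k (q b)" if b: "b \<in> B" for k b
    proof -
      have "(\<Sum>e\<in>q ` B. (\<lambda>x. k e * e x)) b = (\<Sum>b'\<in>B. k (q b') * q b' b)"
        by (simp add: sum_fun_apply sum.reindex[OF inj])
      also have "\<dots> = (\<Sum>b'\<in>B. if b' = b then k (q b') else 0)"
        by (rule sum.cong) (auto simp: qv b)
      finally show ?thesis using fin b by simp
    qed
    have comb: "form d (\<Sum>e\<in>q ` B. (\<lambda>x. k e * e x))" for k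
      unfolding sum_fun_eq by (intro form_sum form_cmult) (auto intro: q)
    have "cfun.dim {f :: complex ^ 'n \<Rightarrow> complex. form d f} = cfun.dim {f \<in> I. form d f} + card (q ` B)"
    proof (rule cfun.dim_eq_dim_add_card[OF forms_finitely_spanned subspace_forms_in_ideal[OF I]])
      show "\<forall>e\<in>q ` B. k e = 0" if "(\<Sum>e\<in>q ` B. (\<lambda>x. k e * e x)) \<in> {f \<in> I. form d f}" for k
        using that form_in_I at_point by auto
      show "\<exists>k. v - (\<Sum>e\<in>q ` B. (\<lambda>x. k e * e x)) \<in> {f \<in> I. form d f}"
        if "v \<in> {f. form d f}" for v
      proof -
        let ?k = "\<lambda>e. v (inv_into B q e)"
        let ?w = "v - (\<Sum>e\<in>q ` B. (\<lambda>x. ?k e * e x))"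
        have "form d (\<lambda>x. v x - (\<Sum>e\<in>q ` B. (\<lambda>x. ?k e * e x)) x)"
          using that by (intro form_diff comb) auto
        then have w: "form d ?w" by (simp add: fun_diff_def)
        have "?w b = 0" if "b \<in> B" for b
          using at_point[OF that, of ?k] that inj by simp
        then have "?w \<in> I" using form_in_I[OF w] by blast
        with w have "?w \<in> {f \<in> I. form d f}" by blast
        then show ?thesis by (rule exI[where x = ?k])
      qed
    qed (use fin q in auto)
    then show ?thesis
      unfolding hilbert_function_def using card_image[OF inj] by simp
  qed
  ultimately show ?thesis
    unfolding zero_dim_subscheme_def eventually_sequentially using hom by blast
qed

text \<open>A maximal independent subset of \<open>S\<close> has the same span and supports a reduced subscheme.\<close>

lemma cactus_rank_le_card:
  fixes X :: "(complex ^ 'n) set"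
  assumes X: "\<And>x t. x \<in> X \<Longrightarrow> t \<noteq> 0 \<Longrightarrow> t *s x \<in> X"
    and S: "finite S" "S \<subseteq> X" and p: "p \<in> vec.span S"
  shows "cactus_rank X p \<le> card S"
proof -
  obtain B where B: "B \<subseteq> S" "vec.independent B" "S \<subseteq> vec.span B"
    using vec.maximal_independent_subset by blast
  have finB: "finite B" using B(1) S(1) by (rule finite_subset)
  let ?P = "{t *s b | t b. b \<in> B \<and> t \<noteq> 0}"
  let ?I = "vanishing_ideal ?P"
  have "?P \<subseteq> X" using X B(1) S(2) by blast
  then have "vanishing_ideal X \<subseteq> ?I" by (auto simp: vanishing_ideal_def)
  moreover have "B \<subseteq> ?P"
  proof
    fix b assume "b \<in> B"
    moreover have "b = 1 *s b" by simp
    ultimately show "b \<in> ?P" using one_neq_zero by blast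
  qed
  then have "?I \<subseteq> vanishing_ideal B" by (auto simp: vanishing_ideal_def)
  then have "vec.span B \<subseteq> scheme_span ?I" by (rule points_in_scheme_span)
  then have "p \<in> scheme_span ?I"
    using p vec.span_minimal[OF B(3) vec.subspace_span] by blast
  moreover have "card B \<le> card S" using B(1) S(1) by (rule card_mono[rotated])
  ultimately have "\<exists>I s. s \<le> card S \<and> zero_dim_subscheme I s \<and> vanishing_ideal X \<subseteq> I \<and> p \<in> scheme_span I"
    using zero_dim_subscheme_points[OF finB B(2)] by blast
  then show ?thesis
    unfolding cactus_rank_def by (intro Inf_lower) blast
qed

lemma cactus_rank_witness:
  assumes "cactus_rank X p \<le> enat r"
  obtains I s where "s \<le> r" "zero_dim_subscheme I s" "vanishing_ideal X \<subseteq> I" "p \<in> scheme_span I"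
proof -
  let ?S = "{r. \<exists>I s. s \<le> r \<and> zero_dim_subscheme I s \<and> vanishing_ideal X \<subseteq> I \<and> p \<in> scheme_span I}"
  have ne: "enat ` ?S \<noteq> {}"
  proof
    assume "enat ` ?S = {}"
    then have "cactus_rank X p = \<infinity>" by (simp only: cactus_rank_def Inf_enat_def simp_thms if_True)
    with assms show False by simp
  qed
  then obtain y where "y \<in> enat ` ?S" by blast
  then have "(LEAST y. y \<in> enat ` ?S) \<in> enat ` ?S" by (rule LeastI)
  then have "cactus_rank X p \<in> enat ` ?S"
    using ne by (simp only: cactus_rank_def Inf_enat_def if_False)
  then obtain r' I s where "cactus_rank X p = enat r'" "s \<le> r'" "zero_dim_subscheme I s"
    "vanishing_ideal X \<subseteq> I" "p \<in> scheme_span I"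
    by auto
  with assms show thesis using that[of s I] by auto
qed

lemma cactus_border_rank_le_cactus_rank:
  assumes "p \<noteq> 0"
  shows "cactus_border_rank X p \<le> cactus_rank X p"
proof (cases "cactus_rank X p")
  case (enat r)
  then have "p \<in> cactus_variety X r"
    using assms by (simp add: cactus_variety_def projective_zariski_closure_def)
  then show ?thesis
    unfolding cactus_border_rank_def enat by (intro Inf_lower) blast
qed simp

lemma cactus_border_rank_geI:
  assumes "form d f" and "f p \<noteq> 0"
    and "\<And>q. cactus_rank X q \<le> enat r \<Longrightarrow> f q = 0"
  shows "cactus_border_rank X p \<ge> enat (Suc r)"
  unfolding cactus_border_rank_def
proof (rule Inf_greatest, elim imageE, simp)
  fix r' assume r': "p \<in> cactus_variety X r'"
  show "Suc r \<le> r'"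
  proof (rule ccontr)
    assume "\<not> Suc r \<le> r'"
    then have "f q = 0" if "cactus_rank X q \<le> enat r'" for q
      using assms(3)[of q] order_trans[OF that, of "enat r"] by simp
    then have "f p = 0"
      using r' assms(1) unfolding cactus_variety_def projective_zariski_closure_def by blast
    with assms(2) show False ..
  qed
qed

section \<open>Zero divisors on the coordinate ring of a zero-dimensional subscheme\<close>

lemma monomials_above_power:
  fixes e :: "'n::finite \<Rightarrow> nat"
  assumes "sum e UNIV = CARD('n) * K" and "K > 0"
  obtains i where "K \<le> e i"
proof (rule ccontr)
  assume "\<not> thesis"
  with that have "\<And>i. e i \<le> K - 1" by (metis Suc_leI Suc_pred' assms(2) leI not_less_eq_eq)
  then have "sum e UNIV \<le> CARD('n) * (K - 1)"
    using sum_bounded_above[of UNIV e "K - 1"] by simp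
  also have "\<dots> < CARD('n) * K" using assms(2) by simp
  finally show False using assms(1) by simp
qed

text \<open>If each coordinate had a power that multiplies \<open>f\<close> into \<open>I\<close>, then all monomials of large degree
  would do so, by the pigeonhole principle, and \<open>f\<close> would be in \<open>I\<close> by saturation.\<close>

lemma coordinate_not_nilpotent_on:
  fixes I :: "(complex ^ 'n \<Rightarrow> complex) set"
  assumes I: "polynomial_ideal I" "saturated I" and f: "polynomial_fun f" "f \<notin> I"
  obtains i where "\<And>k. (\<lambda>x. x $ i ^ k * f x) \<notin> I"
proof (rule ccontr)
  assume "\<not> thesis"
  then have "\<forall>i. \<exists>k. (\<lambda>x. x $ i ^ k * f x) \<in> I" using that by blast
  then obtain k where k: "\<And>i. (\<lambda>x. x $ i ^ k i * f x) \<in> I" by metis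
  define K where "K = Suc (Max (range k))"
  have kK: "k i \<le> K" for i
  proof -
    have "k i \<le> Max (range k)" by (intro Max_ge) auto
    then show ?thesis unfolding K_def by (rule le_SucI)
  qed
  let ?d = "CARD('n) * K"
  have monom: "(\<lambda>x. monom_fun e x * f x) \<in> I" if e: "sum e UNIV = ?d" for e
  proof -
    obtain i where i: "K \<le> e i" using monomials_above_power[OF e] by (auto simp: K_def)
    have "(\<lambda>x. x $ i ^ (e i - k i) * (\<Prod>j\<in>UNIV - {i}. x $ j ^ e j) * (x $ i ^ k i * f x)) \<in> I"
      by (intro ideal_mult I k polynomial_fun_intros)
    also have "(\<lambda>x. x $ i ^ (e i - k i) * (\<Prod>j\<in>UNIV - {i}. x $ j ^ e j) * (x $ i ^ k i * f x))
        = (\<lambda>x. monom_fun e x * f x)"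
    proof
      fix x :: "complex ^ 'n"
      have "monom_fun e x = x $ i ^ e i * (\<Prod>j\<in>UNIV - {i}. x $ j ^ e j)"
        unfolding monom_fun_def by (rule prod.remove) auto
      moreover have "x $ i ^ e i = x $ i ^ (e i - k i) * x $ i ^ k i"
        using order_trans[OF kK i] by (simp flip: power_add)
      ultimately show "x $ i ^ (e i - k i) * (\<Prod>j\<in>UNIV - {i}. x $ j ^ e j) * (x $ i ^ k i * f x)
          = monom_fun e x * f x"
        by (simp add: mult_ac)
    qed
    finally show ?thesis .
  qed
  have "(\<lambda>x. g x * f x) \<in> I" if "form ?d g" for g
    using form_in_span[OF that]
  proof (induction rule: cfun.span_induct_alt)
    case base
    then show ?case using ideal_zero[OF I(1)] by simp
  next
    case (step c m g)
    then obtain e where e: "m = monom_fun e" "sum e UNIV = ?d" by blast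
    have "(\<lambda>x. c * (monom_fun e x * f x) + g x * f x) \<in> I"
      by (intro ideal_add ideal_cmult I(1) monom e(2) step(2))
    then show ?case by (simp add: e(1) algebra_simps)
  qed
  then have "f \<in> I" using I(2) f(1) unfolding saturated_def by blast
  with f(2) show False ..
qed

text \<open>The ideal quotient \<open>(I : f)\<close>.\<close>

definition colon :: "(complex ^ 'n \<Rightarrow> complex) set \<Rightarrow> (complex ^ 'n \<Rightarrow> complex) \<Rightarrow> (complex ^ 'n \<Rightarrow> complex) set" where
  "colon I f = {h. polynomial_fun h \<and> (\<lambda>x. h x * f x) \<in> I}"

lemma polynomial_ideal_colon:
  fixes I :: "(complex ^ 'n \<Rightarrow> complex) set"
  assumes "polynomial_ideal I"
  shows "polynomial_ideal (colon I f)"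
  unfolding polynomial_ideal_def colon_def
proof (intro conjI ballI allI impI CollectI)
  fix g h assume g: "g \<in> {h. polynomial_fun h \<and> (\<lambda>x. h x * f x) \<in> I}"
  then show "polynomial_fun g" by simp
  assume h: "h \<in> {h. polynomial_fun h \<and> (\<lambda>x. h x * f x) \<in> I}"
  with g show "polynomial_fun (\<lambda>x. g x + h x)" by (auto intro: polynomial_fun_intros)
  show "(\<lambda>x. (g x + h x) * f x) \<in> I"
    using ideal_add[OF assms, of "\<lambda>x. g x * f x" "\<lambda>x. h x * f x"] g h by (simp add: algebra_simps)
next
  fix g h :: "complex ^ 'n \<Rightarrow> complex"
  assume g: "g \<in> {h. polynomial_fun h \<and> (\<lambda>x. h x * f x) \<in> I}" and h: "polynomial_fun h"
  then show "polynomial_fun (\<lambda>x. h x * g x)" by (auto intro: polynomial_fun_intros)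
  show "(\<lambda>x. h x * g x * f x) \<in> I"
    using ideal_mult[OF assms, of "\<lambda>x. g x * f x" h] g h by (simp add: mult.assoc)
qed (use ideal_zero[OF assms] in \<open>auto intro: polynomial_fun_intros\<close>)

lemma colon_mult_subset:
  assumes I: "polynomial_ideal I" and h: "polynomial_fun h"
  shows "colon I f \<subseteq> colon I (\<lambda>x. h x * f x)"
proof
  fix r assume r: "r \<in> colon I f"
  then have "(\<lambda>x. r x * f x) \<in> I" by (simp add: colon_def)
  then have "(\<lambda>x. h x * (r x * f x)) \<in> I" using h by (rule ideal_mult[OF I])
  with r show "r \<in> colon I (\<lambda>x. h x * f x)" by (simp add: colon_def mult_ac)
qed

text \<open>The binary form of degree \<open>m\<close> that dehomogenizes to \<open>p\<close>; for \<open>degree p \<le> m\<close>, it is divisible by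
  \<open>b ^ (m - degree p)\<close>.\<close>

definition homogenization :: "nat \<Rightarrow> complex poly \<Rightarrow> complex \<Rightarrow> complex \<Rightarrow> complex" where
  "homogenization m p a b = (\<Sum>i\<le>m. coeff p i * (a ^ i * b ^ (m - i)))"

lemma homogenization_Suc:
  assumes "degree p \<le> m"
  shows "homogenization (Suc m) p a b = b * homogenization m p a b"
proof -
  have "coeff p (Suc m) = 0" using assms by (simp add: coeff_eq_0)
  then have "homogenization (Suc m) p a b = (\<Sum>i\<le>m. coeff p i * (a ^ i * b ^ (Suc m - i)))"
    by (simp add: homogenization_def)
  also have "\<dots> = (\<Sum>i\<le>m. b * (coeff p i * (a ^ i * b ^ (m - i))))"
    by (rule sum.cong) (auto simp: Suc_diff_le)
  finally show ?thesis by (simp add: homogenization_def sum_distrib_left)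
qed

lemma homogenization_add_power:
  assumes "degree p \<le> m"
  shows "homogenization (k + m) p a b = b ^ k * homogenization m p a b"
  using assms by (induction k) (auto simp: homogenization_Suc)

lemma homogenization_linear_factor:
  assumes "degree p \<le> m"
  shows "homogenization (Suc m) ([:- r, 1:] * p) a b = (a - r * b) * homogenization m p a b"
proof -
  have "homogenization (Suc m) ([:- r, 1:] * p) a b =
      (\<Sum>i\<le>Suc m. coeff (pCons 0 p) i * (a ^ i * b ^ (Suc m - i))) - r * homogenization (Suc m) p a b"
    by (simp add: homogenization_def algebra_simps sum_subtractf sum_distrib_left sum.distrib sum_negf del: sum.atMost_Suc)
  also have "(\<Sum>i\<le>Suc m. coeff (pCons 0 p) i * (a ^ i * b ^ (Suc m - i))) = a * homogenization m p a b"
    by (subst sum.atMost_Suc_shift)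
      (simp add: homogenization_def sum_distrib_left mult_ac coeff_pCons_Suc)
  finally show ?thesis
    by (simp add: homogenization_Suc[OF assms] algebra_simps)
qed

lemma polynomial_fun_homogenization:
  "polynomial_fun f \<Longrightarrow> polynomial_fun g \<Longrightarrow> polynomial_fun (\<lambda>x. homogenization m p (f x) (g x))"
  unfolding homogenization_def by (intro polynomial_fun_intros)

text \<open>A binary form in \<open>u\<close> and \<open>v\<close> that annihilates \<open>g\<close> modulo \<open>I\<close> is a product of linear factors.
  These are removed one after the other, until the product of the remaining factors and \<open>g\<close> is
  not annihilated by a power of \<open>v\<close>. The factor that was removed last is \<open>u - r v\<close>. In other words,
  \<open>r\<close> is an eigenvalue of \<open>u / v\<close> on the multiples of \<open>g\<close>.\<close>

lemma eigenvalue_from_binary_form: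
  assumes I: "polynomial_ideal I" and u: "polynomial_fun u" and v: "polynomial_fun v"
  shows "degree p \<le> m \<Longrightarrow> p \<noteq> 0 \<Longrightarrow> polynomial_fun g \<Longrightarrow> (\<And>k. (\<lambda>x. v x ^ k * g x) \<notin> I) \<Longrightarrow>
    (\<lambda>x. homogenization m p (u x) (v x) * g x) \<in> I \<Longrightarrow>
    \<exists>h r. polynomial_fun h \<and> (\<forall>k. (\<lambda>x. v x ^ k * (h x * g x)) \<notin> I) \<and>
      (\<lambda>x. (u x - r * v x) * (h x * g x)) \<in> I"
proof (induction "degree p" arbitrary: p m)
  case 0
  then obtain c where p: "p = [:c:]" by (metis degree_eq_zeroE)
  have "homogenization m p a b = c * b ^ m" for a b
    using homogenization_add_power[of p 0 m a b] 0(1) by (simp add: homogenization_def p)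
  then have "(\<lambda>x. c * v x ^ m * g x) \<in> I" using 0 by simp
  then have "(\<lambda>x. (1 / c) * (c * v x ^ m * g x)) \<in> I" by (rule ideal_cmult[OF I])
  moreover have "c \<noteq> 0" using 0 p by simp
  ultimately have "(\<lambda>x. v x ^ m * g x) \<in> I" by simp
  with 0 show ?case by blast
next
  case (Suc n)
  obtain r where "poly p r = 0"
    using fundamental_theorem_of_algebra[of p] Suc(2) by (auto simp: constant_degree)
  then obtain q where q: "p = [:- r, 1:] * q" by (auto simp: poly_eq_0_iff_dvd)
  have q0: "q \<noteq> 0" using Suc q by auto
  have dq: "degree p = Suc (degree q)"
    unfolding q by (subst degree_mult_eq) (use q0 in auto)
  then obtain m' where m: "m = Suc m'" "degree q \<le> m'" using Suc(3) by (cases m) auto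
  let ?h = "\<lambda>x. homogenization m' q (u x) (v x)"
  have h: "polynomial_fun ?h" by (rule polynomial_fun_homogenization[OF u v])
  have fac: "(\<lambda>x. (u x - r * v x) * (?h x * g x)) \<in> I"
    using Suc(7) unfolding m q homogenization_linear_factor[OF m(2)] by (simp add: mult.assoc)
  show ?case
  proof (cases "\<forall>k. (\<lambda>x. v x ^ k * (?h x * g x)) \<notin> I")
    case True
    with h fac show ?thesis by blast
  next
    case False
    then obtain k where "(\<lambda>x. v x ^ k * (?h x * g x)) \<in> I" by blast
    then have "(\<lambda>x. homogenization (k + m') q (u x) (v x) * g x) \<in> I"
      by (simp add: homogenization_add_power[OF m(2)] mult.assoc)
    then show ?thesis
      using Suc(1)[of q "k + m'"] Suc(2,5,6) dq m(2) q0 by simp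
  qed
qed

text \<open>The \<open>d + 1\<close> monomials of degree \<open>d\<close> in \<open>u\<close> and \<open>v\<close> are dependent modulo \<open>I\<close>.\<close>

lemma binary_form_in_ideal:
  assumes I: "polynomial_ideal I" and s: "hilbert_function I d = s" "s \<le> d"
    and u: "form 1 u" and v: "form 1 v"
  obtains p where "degree p \<le> d" "p \<noteq> 0" "(\<lambda>x. homogenization d p (u x) (v x)) \<in> I"
proof -
  have f: "form d (\<lambda>x. u x ^ i * v x ^ (d - i))" if "i \<le> d" for i
    using form_mult[OF form_1_power[OF u, of i] form_1_power[OF v, of "d - i"]] that by simp
  obtain c where c: "\<exists>j\<in>{..d}. c j \<noteq> 0"
    "\<And>r. r \<in> {()} \<Longrightarrow> (\<lambda>x. \<Sum>j\<in>{..d}. c j * (u x ^ j * v x ^ (d - j))) \<in> I"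
    by (rule nontrivial_combination_in_ideal[OF I s(1), of "{()}" "{..d}" "\<lambda>_ i x. u x ^ i * v x ^ (d - i)"])
      (use f s(2) in auto)
  define p where "p = (\<Sum>i\<le>d. monom (c i) i)"
  have cp: "coeff p i = (if i \<le> d then c i else 0)" for i
    by (simp add: p_def coeff_sum)
  show thesis
  proof (rule that)
    show "degree p \<le> d" by (rule degree_le) (simp add: cp)
    show "p \<noteq> 0" using c(1) cp by (metis atMost_iff coeff_0)
    show "(\<lambda>x. homogenization d p (u x) (v x)) \<in> I"
      using c(2) by (simp add: homogenization_def cp)
  qed
qed

text \<open>An elementary substitute for associated primes. Replacing \<open>f\<close> by suitable multiples outside
  \<open>I\<close>, one coordinate after the other becomes a scalar multiple \<open>z\<^sub>j\<close> of a fixed coordinate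
  \<open>x\<^sub>0\<close> modulo the annihilator, while no power of \<open>x\<^sub>0\<close> is in the annihilator. In the end a form
  \<open>h\<close> of degree \<open>e\<close> acts as \<open>h z x\<^sub>0\<^sup>e\<close>. If \<open>h\<close> annihilates \<open>f\<close>, it annihilates the multiples of
  \<open>f\<close>, so \<open>h z = 0\<close>.\<close>

lemma zero_divisor_vanishes_at_point:
  fixes I :: "(complex ^ 'n \<Rightarrow> complex) set"
  assumes I: "polynomial_ideal I" "saturated I" and s: "hilbert_function I d = s" "s \<le> d"
    and f: "polynomial_fun f" "f \<notin> I"
  obtains z where "z \<noteq> 0" "\<And>e h. form e h \<Longrightarrow> (\<lambda>x. h x * f x) \<in> I \<Longrightarrow> h z = 0"
proof -
  obtain i0 where i0: "\<And>k. (\<lambda>x. x $ i0 ^ k * f x) \<notin> I"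
    using coordinate_not_nilpotent_on[OF I f] by blast
  have "\<exists>g z. polynomial_fun g \<and> colon I f \<subseteq> colon I g \<and> (\<forall>k. (\<lambda>x. x $ i0 ^ k * g x) \<notin> I) \<and>
      (\<forall>j\<in>S. (\<lambda>x. x $ j - z j * x $ i0) \<in> colon I g)" if "finite S" for S
    using that
  proof (induction S rule: finite_induct)
    case empty
    show ?case using f i0 by blast
  next
    case (insert j S)
    then obtain g z where g: "polynomial_fun g" "colon I f \<subseteq> colon I g"
      "\<And>k. (\<lambda>x. x $ i0 ^ k * g x) \<notin> I" "\<forall>j\<in>S. (\<lambda>x. x $ j - z j * x $ i0) \<in> colon I g"
      by blast
    obtain p where p: "degree p \<le> d" "p \<noteq> 0" "(\<lambda>x. homogenization d p (x $ j) (x $ i0)) \<in> I"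
      using binary_form_in_ideal[OF I(1) s form_coord form_coord] by blast
    have "(\<lambda>x. homogenization d p (x $ j) (x $ i0) * g x) \<in> I"
      using ideal_mult[OF I(1) p(3) g(1)] by (simp add: mult.commute)
    then obtain h r where h: "polynomial_fun h" "\<forall>k. (\<lambda>x. x $ i0 ^ k * (h x * g x)) \<notin> I"
      "(\<lambda>x. (x $ j - r * x $ i0) * (h x * g x)) \<in> I"
      using eigenvalue_from_binary_form[OF I(1) polynomial_fun.coord[of j] polynomial_fun.coord[of i0] p(1,2) g(1,3)]
      by blast
    have sub: "colon I g \<subseteq> colon I (\<lambda>x. h x * g x)" by (rule colon_mult_subset[OF I(1) h(1)])
    have "(\<lambda>x. x $ j - r * x $ i0) \<in> colon I (\<lambda>x. h x * g x)"
      using h(3) by (auto simp: colon_def intro!: polynomial_fun_intros)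
    moreover have "(\<lambda>x. x $ l - z l * x $ i0) \<in> colon I (\<lambda>x. h x * g x)" if "l \<in> S" for l
      using g(4) that sub by blast
    ultimately have "\<forall>l\<in>insert j S. (\<lambda>x. x $ l - (z(j := r)) l * x $ i0) \<in> colon I (\<lambda>x. h x * g x)"
      using insert.hyps(2) by auto
    moreover have "polynomial_fun (\<lambda>x. h x * g x)" using h(1) g(1) by (rule polynomial_fun.mult)
    ultimately show ?case using g(2) sub h(2) by blast
  qed
  from this[OF finite_class.finite_UNIV] obtain g z where g: "polynomial_fun g" "colon I f \<subseteq> colon I g"
    "\<And>k. (\<lambda>x. x $ i0 ^ k * g x) \<notin> I" "\<And>j. (\<lambda>x. x $ j - z j * x $ i0) \<in> colon I g"
    by blast
  define Z where "Z = (\<chi> j. z j)"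
  have J: "polynomial_ideal (colon I g)" by (rule polynomial_ideal_colon[OF I(1)])
  have power_notin: "c = 0" if "(\<lambda>x. c * x $ i0 ^ k) \<in> colon I g" for c k
  proof (rule ccontr)
    assume c: "c \<noteq> 0"
    have "(\<lambda>x. (1 / c) * (c * x $ i0 ^ k)) \<in> colon I g"
      using that by (rule ideal_cmult[OF J])
    with c g(3) show False by (simp add: colon_def)
  qed
  show thesis
  proof (rule that)
    have "(\<lambda>x. (1 - z i0) * x $ i0 ^ 1) \<in> colon I g"
      using g(4)[of i0] by (simp add: algebra_simps)
    then have "1 - z i0 = 0" by (rule power_notin)
    then have "Z $ i0 \<noteq> 0" by (simp add: Z_def)
    then show "Z \<noteq> 0" by (metis zero_index)
    fix e h assume h: "form e h" "(\<lambda>x. h x * f x) \<in> I"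
    have "h \<in> colon I g" using h g(2) form_imp_polynomial_fun by (auto simp: colon_def)
    moreover have "(\<lambda>x. h x - h (x $ i0 *s Z)) \<in> colon I g"
    proof (rule conjunct2[OF substitution_congruence[OF J]])
      show "polynomial_fun (\<lambda>x. (x $ i0 *s Z) $ i)" for i
        by (auto intro: polynomial_fun_intros)
      show "(\<lambda>x. x $ i - (x $ i0 *s Z) $ i) \<in> colon I g" for i
        using g(4)[of i] by (simp add: Z_def mult.commute)
      show "polynomial_fun h" by (rule form_imp_polynomial_fun[OF h(1)])
    qed
    ultimately have "(\<lambda>x. h x - (h x - h (x $ i0 *s Z))) \<in> colon I g"
      by (rule ideal_diff[OF J])
    then have "(\<lambda>x. h Z * x $ i0 ^ e) \<in> colon I g"
      by (simp add: form_scale[OF h(1)] mult.commute)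
    then show "h Z = 0" by (rule power_notin)
  qed
qed

section \<open>Nonzerodivisors\<close>

text \<open>A product of linear forms, one for each other point, times a power of a coordinate that fills
  up the degree.\<close>

lemma interpolating_form:
  fixes Y :: "(complex ^ 'n) set"
  assumes fin: "finite Y" and y: "y \<in> Y" "y \<noteq> 0"
    and sep: "\<And>y'. y' \<in> Y \<Longrightarrow> y' \<noteq> y \<Longrightarrow> y \<notin> vec.span {y'}" and d: "card Y \<le> d"
  shows "\<exists>g. form d g \<and> g y \<noteq> 0 \<and> (\<forall>y'\<in>Y - {y}. g y' = 0)"
proof -
  have "\<exists>l. form 1 l \<and> l y' = 0 \<and> l y = 1" if y': "y' \<in> Y - {y}" for y'
  proof -
    have "y \<notin> vec.span {y'}" using sep y' by blast
    then obtain l where "form 1 l" "\<And>w. w \<in> vec.span {y'} \<Longrightarrow> l w = 0" "l y = 1"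
      using separating_functional[OF vec.subspace_span] by blast
    then show ?thesis by (intro exI[of _ l]) (auto intro: vec.span_base)
  qed
  then obtain l where l: "\<And>y'. y' \<in> Y - {y} \<Longrightarrow> form 1 (l y')"
    "\<And>y'. y' \<in> Y - {y} \<Longrightarrow> l y' y' = 0" "\<And>y'. y' \<in> Y - {y} \<Longrightarrow> l y' y = 1"
    by metis
  obtain i where i: "y $ i \<noteq> 0" using y(2) by (auto simp: vec_eq_iff)
  let ?m = "card (Y - {y})"
  let ?g = "\<lambda>x. (\<Prod>y'\<in>Y - {y}. l y' x) * x $ i ^ (d - ?m)"
  have "?m \<le> d" using fin d card_mono[of Y "Y - {y}"] by simp
  moreover have "form (sum (\<lambda>_. 1) (Y - {y}) + (d - ?m)) ?g"
    by (intro form_mult form_prod l form_1_power form_coord)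
  ultimately have "form d ?g" by simp
  moreover have "?g y \<noteq> 0" using l(3) i by simp
  moreover have "?g y' = 0" if "y' \<in> Y - {y}" for y'
  proof -
    have "(\<Prod>y''\<in>Y - {y}. l y'' y') = 0"
      using fin that l(2)[OF that] by (intro prod_zero) auto
    then show ?thesis by simp
  qed
  ultimately show ?thesis by (intro exI[of _ ?g]) blast
qed

definition projective_zeros :: "(complex ^ 'n \<Rightarrow> complex) set \<Rightarrow> (complex ^ 'n) set" where
  "projective_zeros I = {z. z \<noteq> 0 \<and> (\<forall>d h. form d h \<and> h \<in> I \<longrightarrow> h z = 0)}"

text \<open>Interpolating forms at pairwise non-proportional zeros are independent modulo \<open>I\<close>, so there
  are at most \<open>s\<close> such zeros, and a set of maximal size represents all lines.\<close>

lemma projective_zeros_finitely_many_lines: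
  fixes I :: "(complex ^ 'n \<Rightarrow> complex) set"
  assumes I: "polynomial_ideal I" and s: "\<forall>\<^sub>F d in sequentially. hilbert_function I d = s"
  obtains Y where "finite Y" "Y \<subseteq> projective_zeros I"
    "\<And>z. z \<in> projective_zeros I \<Longrightarrow> \<exists>y\<in>Y. z \<in> vec.span {y}"
proof -
  define P where "P Y \<longleftrightarrow> finite Y \<and> Y \<subseteq> projective_zeros I \<and>
    (\<forall>y\<in>Y. \<forall>y'\<in>Y. y' \<noteq> y \<longrightarrow> y \<notin> vec.span {y'})" for Y
  have bound: "card Y \<le> s" if Y: "P Y" for Y
  proof (rule ccontr)
    assume less: "\<not> card Y \<le> s"
    obtain d0 where d0: "\<And>d. d \<ge> d0 \<Longrightarrow> hilbert_function I d = s"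
      using s unfolding eventually_sequentially by blast
    let ?d = "max d0 (card Y)"
    have "\<forall>y\<in>Y. \<exists>g. form ?d g \<and> g y \<noteq> 0 \<and> (\<forall>y'\<in>Y - {y}. g y' = 0)"
    proof
      fix y assume "y \<in> Y"
      then show "\<exists>g. form ?d g \<and> g y \<noteq> 0 \<and> (\<forall>y'\<in>Y - {y}. g y' = 0)"
        using Y by (intro interpolating_form) (auto simp: P_def projective_zeros_def)
    qed
    then obtain g where g: "\<And>y. y \<in> Y \<Longrightarrow> form ?d (g y)" "\<And>y. y \<in> Y \<Longrightarrow> g y y \<noteq> 0"
      "\<And>y y'. y \<in> Y \<Longrightarrow> y' \<in> Y - {y} \<Longrightarrow> g y y' = 0"
      by metis
    have fin: "finite Y" using Y by (simp add: P_def)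
    obtain c where c: "\<exists>y\<in>Y. c y \<noteq> 0" "\<And>r. r \<in> {()} \<Longrightarrow> (\<lambda>x. \<Sum>y\<in>Y. c y * g y x) \<in> I"
      by (rule nontrivial_combination_in_ideal[OF I d0[of ?d], of "{()}" Y "\<lambda>_. g"])
        (use fin less g(1) in auto)
    then obtain y where y: "y \<in> Y" "c y \<noteq> 0" by blast
    have "form ?d (\<lambda>x. \<Sum>y\<in>Y. c y * g y x)"
      by (intro form_sum form_cmult g(1))
    then have "(\<Sum>y'\<in>Y. c y' * g y' y) = 0"
      using c(2)[of "()"] y(1) Y unfolding P_def projective_zeros_def by blast
    moreover have "(\<Sum>y'\<in>Y. c y' * g y' y) = (\<Sum>y'\<in>Y. if y' = y then c y * g y y else 0)"
      by (rule sum.cong) (auto simp: g(3) y(1))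
    ultimately show False using y fin g(2) by simp
  qed
  have "P {}" by (simp add: P_def)
  moreover have "\<forall>Y. P Y \<longrightarrow> card Y < Suc s" using bound by (simp add: less_Suc_eq_le)
  ultimately obtain Y where Y: "P Y" "\<And>Y'. P Y' \<Longrightarrow> card Y' \<le> card Y"
    using ex_has_greatest_nat[of P "{}" card "Suc s"] by blast
  show thesis
  proof (rule that)
    show "finite Y" "Y \<subseteq> projective_zeros I" using Y(1) by (auto simp: P_def)
    fix z assume z: "z \<in> projective_zeros I"
    show "\<exists>y\<in>Y. z \<in> vec.span {y}"
    proof (rule ccontr)
      assume contra: "\<not> (\<exists>y\<in>Y. z \<in> vec.span {y})"
      have "y \<notin> vec.span {z}" if y: "y \<in> Y" for y
      proof
        assume "y \<in> vec.span {z}"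
        then obtain t where t: "y = t *s z" by (auto simp: vec.span_singleton)
        moreover have "y \<noteq> 0" using y Y(1) by (auto simp: P_def projective_zeros_def)
        ultimately have "z = (1 / t) *s y" by auto
        then have "z \<in> vec.span {y}" using vec.span_scale[OF vec.span_base] by blast
        with contra y show False by blast
      qed
      with contra z Y(1) have "P (insert z Y)" by (auto simp: P_def)
      then have "card (insert z Y) \<le> card Y" by (rule Y(2))
      moreover have "z \<notin> Y" using contra vec.span_base by blast
      ultimately show False using Y(1) by (simp add: P_def)
    qed
  qed
qed

text \<open>If \<open>l f \<in> I\<close> and \<open>f \<notin> I\<close>, there is a point that is a zero of \<open>l\<close> and of \<open>I\<close>, as all elements of
  \<open>I\<close> annihilate \<open>f\<close> too. The assumption on the values of \<open>l\<close> on \<open>Y\<close> excludes this.\<close>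

lemma nonzerodivisor:
  fixes I :: "(complex ^ 'n \<Rightarrow> complex) set"
  assumes I: "polynomial_ideal I" "saturated I"
    and s: "\<forall>\<^sub>F d in sequentially. hilbert_function I d = s"
    and Y: "\<And>z. z \<in> projective_zeros I \<Longrightarrow> \<exists>y\<in>Y. z \<in> vec.span {y}"
    and l: "form 1 l" "\<And>y. y \<in> Y \<Longrightarrow> l y \<noteq> 0"
    and f: "polynomial_fun f" "(\<lambda>x. l x * f x) \<in> I"
  shows "f \<in> I"
proof (rule ccontr)
  assume nf: "f \<notin> I"
  obtain d where d: "hilbert_function I d = s" "s \<le> d"
    using s unfolding eventually_sequentially by (meson max.cobounded1 max.cobounded2)
  obtain z where z: "z \<noteq> 0" "\<And>e h. form e h \<Longrightarrow> (\<lambda>x. h x * f x) \<in> I \<Longrightarrow> h z = 0"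
    using zero_divisor_vanishes_at_point[OF I d f(1) nf] by blast
  have "h z = 0" if "form e h" "h \<in> I" for e h
    using z(2)[OF that(1)] ideal_mult[OF I(1) that(2) f(1)] by (simp add: mult.commute)
  then have "z \<in> projective_zeros I" using z(1) by (auto simp: projective_zeros_def)
  then obtain y t where y: "y \<in> Y" "z = t *s y"
    using Y[OF \<open>z \<in> projective_zeros I\<close>] unfolding vec.span_singleton by blast
  have "t * l y = 0" using z(2)[OF l(1) f(2)] form_scale[OF l(1)] y(2) by simp
  then show False using l(2)[OF y(1)] z(1) y(2) by simp
qed

lemma nonzerodivisor_power:
  assumes nzd: "\<And>f. polynomial_fun f \<Longrightarrow> (\<lambda>x. l x * f x) \<in> I \<Longrightarrow> f \<in> I"
    and l: "polynomial_fun l" and f: "polynomial_fun f" "(\<lambda>x. l x ^ k * f x) \<in> I"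
  shows "f \<in> I"
  using f(2)
proof (induction k)
  case (Suc k)
  have "(\<lambda>x. l x ^ k * f x) \<in> I"
  proof (rule nzd)
    show "polynomial_fun (\<lambda>x. l x ^ k * f x)" using l f(1) by (intro polynomial_fun_intros)
    show "(\<lambda>x. l x * (l x ^ k * f x)) \<in> I" using Suc.prems by (simp add: mult.assoc)
  qed
  then show ?case by (rule Suc.IH)
qed simp

section \<open>Koszul flattenings and the lower bound\<close>

text \<open>Choose the functional on the curve \<open>(1, t, t\<^sup>2)\<close>, which meets each hyperplane in finitely many
  points. The normalization of the first entry allows to solve for the first of three dependent
  conditions in \<open>koszul_kernel\<close>.\<close>

lemma functional_avoiding_hyperplanes:
  fixes w :: "'y \<Rightarrow> 3 \<Rightarrow> complex"
  assumes "finite Y" and "\<And>y. y \<in> Y \<Longrightarrow> \<exists>i. w y i \<noteq> 0"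
  obtains \<alpha> :: "3 \<Rightarrow> complex" where "\<alpha> 1 = 1" "\<And>y. y \<in> Y \<Longrightarrow> (\<Sum>i\<in>UNIV. \<alpha> i * w y i) \<noteq> 0"
proof -
  define q where "q y = [:w y 1, w y 2, w y 3:]" for y
  have "q y \<noteq> 0" if y: "y \<in> Y" for y
  proof -
    obtain i where "w y i \<noteq> 0" using assms(2)[OF y] by blast
    then show ?thesis using exhaust_3[of i] by (auto simp: q_def)
  qed
  then have "finite (\<Union>y\<in>Y. {t. poly (q y) t = 0})"
    using assms(1) poly_roots_finite by blast
  then obtain t where t: "t \<notin> (\<Union>y\<in>Y. {t. poly (q y) t = 0})"
    using ex_new_if_finite[OF infinite_UNIV_char_0] by blast
  define \<alpha> :: "3 \<Rightarrow> complex" where "\<alpha> i = (if i = 1 then 1 else if i = 2 then t else t ^ 2)" for i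
  have "(\<Sum>i\<in>UNIV. \<alpha> i * w y i) = poly (q y) t" for y
    by (simp add: sum_3 \<alpha>_def q_def algebra_simps power2_eq_square)
  with t show thesis by (intro that[of \<alpha>]) (auto simp: \<alpha>_def)
qed

text \<open>On the Segre variety, \<open>U i j k\<close> is \<open>x\<^sub>i y\<^sub>j z\<^sub>k\<close>. Contracting with functionals
  \<open>\<alpha>, \<beta>, \<gamma>\<close> on all factors or all but one gives linear forms \<open>l, A\<^sub>i, B\<^sub>j, C\<^sub>k\<close>, where
  \<open>l\<^sup>2 U i j k = A\<^sub>i B\<^sub>j C\<^sub>k\<close> on the Segre variety. Thus \<open>A\<^sub>i / l\<close> acts on the coordinate ring of the
  subscheme, and these three actions commute. A vector \<open>v\<close> is in the kernel of the flattening if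
  the elements \<open>W\<^sub>i = \<Sum>\<^sub>j v\<^sub>i\<^sub>j B\<^sub>j\<close> satisfy \<open>W\<^sub>i = (A\<^sub>i / l) W\<close> for a common \<open>W\<close>. As
  \<open>\<Sum>\<^sub>i \<alpha>\<^sub>i A\<^sub>i = l\<close>, this \<open>W\<close> has to be \<open>\<Sum>\<^sub>i \<alpha>\<^sub>i W\<^sub>i\<close>, and the combination of the three
  conditions with coefficients \<open>\<alpha>\<^sub>i\<close> holds anyway; two conditions remain.\<close>

lemma koszul_kernel:
  fixes U :: "3 \<Rightarrow> 3 \<Rightarrow> 3 \<Rightarrow> complex ^ 'n \<Rightarrow> complex"
  assumes sch: "zero_dim_subscheme I s" "s \<le> 4" and XI: "vanishing_ideal X \<subseteq> I"
    and p: "p \<in> scheme_span I"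
    and U: "\<And>i j k. form 1 (U i j k)"
    and X: "\<And>q. q \<in> X \<Longrightarrow> \<exists>x y z. \<forall>i j k. U i j k q = x i * y j * z k"
    and nondeg: "\<And>q. q \<noteq> 0 \<Longrightarrow> \<exists>i j k. U i j k q \<noteq> 0"
  obtains v :: "3 \<Rightarrow> 3 \<Rightarrow> complex" where "\<exists>i j. v i j \<noteq> 0"
    "\<And>i i' k. (\<Sum>j\<in>UNIV. U i j k p * v i' j) = (\<Sum>j\<in>UNIV. U i' j k p * v i j)"
proof -
  have I: "polynomial_ideal I" "saturated I"
    and s: "\<forall>\<^sub>F d in sequentially. hilbert_function I d = s"
    using sch(1) by (auto simp: zero_dim_subscheme_def homogeneous_ideal_def)
  obtain Y where Y: "finite Y" "Y \<subseteq> projective_zeros I"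
    "\<And>z. z \<in> projective_zeros I \<Longrightarrow> \<exists>y\<in>Y. z \<in> vec.span {y}"
    using projective_zeros_finitely_many_lines[OF I(1) s] by blast
  have "\<forall>y\<in>Y. \<exists>i j k. U i j k y \<noteq> 0"
    using Y(2) nondeg by (auto simp: projective_zeros_def)
  then obtain j0 k0 where jk: "\<And>y. y \<in> Y \<Longrightarrow> \<exists>i. U i (j0 y) (k0 y) y \<noteq> 0" by metis
  obtain \<alpha> where \<alpha>: "\<alpha> (1::3) = 1"
    "\<And>y. y \<in> Y \<Longrightarrow> (\<Sum>i\<in>UNIV. \<alpha> i * U i (j0 y) (k0 y) y) \<noteq> 0"
    using functional_avoiding_hyperplanes[OF Y(1), of "\<lambda>y i. U i (j0 y) (k0 y) y"] jk by blast
  obtain \<beta> :: "3 \<Rightarrow> complex" where \<beta>: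
    "\<And>y. y \<in> Y \<Longrightarrow> (\<Sum>j\<in>UNIV. \<beta> j * (\<Sum>i\<in>UNIV. \<alpha> i * U i j (k0 y) y)) \<noteq> 0"
    using functional_avoiding_hyperplanes[OF Y(1), of "\<lambda>y j. \<Sum>i\<in>UNIV. \<alpha> i * U i j (k0 y) y"] \<alpha>(2) by blast
  obtain \<gamma> :: "3 \<Rightarrow> complex" where \<gamma>:
    "\<And>y. y \<in> Y \<Longrightarrow> (\<Sum>k\<in>UNIV. \<gamma> k * (\<Sum>j\<in>UNIV. \<beta> j * (\<Sum>i\<in>UNIV. \<alpha> i * U i j k y))) \<noteq> 0"
    using functional_avoiding_hyperplanes[OF Y(1), of "\<lambda>y k. \<Sum>j\<in>UNIV. \<beta> j * (\<Sum>i\<in>UNIV. \<alpha> i * U i j k y)"] \<beta> by blast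
  define l where "l x = (\<Sum>k\<in>UNIV. \<gamma> k * (\<Sum>j\<in>UNIV. \<beta> j * (\<Sum>i\<in>UNIV. \<alpha> i * U i j k x)))" for x
  define A where "A i x = (\<Sum>k\<in>UNIV. \<gamma> k * (\<Sum>j\<in>UNIV. \<beta> j * U i j k x))" for i x
  define B where "B j x = (\<Sum>k\<in>UNIV. \<gamma> k * (\<Sum>i\<in>UNIV. \<alpha> i * U i j k x))" for j x
  define C where "C k x = (\<Sum>j\<in>UNIV. \<beta> j * (\<Sum>i\<in>UNIV. \<alpha> i * U i j k x))" for k x
  have form_l: "form 1 l" and form_A: "\<And>i. form 1 (A i)" and form_B: "\<And>j. form 1 (B j)"
    and form_C: "\<And>k. form 1 (C k)"
    unfolding l_def A_def B_def C_def by (intro form_sum form_cmult U)+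
  note poly_form = form_imp_polynomial_fun[OF form_l] form_imp_polynomial_fun[OF form_A]
    form_imp_polynomial_fun[OF form_B] form_imp_polynomial_fun[OF form_C] form_imp_polynomial_fun[OF U]
  have nzd: "f \<in> I" if "polynomial_fun f" "(\<lambda>x. l x * f x) \<in> I" for f
    using nonzerodivisor[OF I s Y(3) form_l _ that] \<gamma> unfolding l_def by blast
  have sum_A: "(\<Sum>i\<in>UNIV. \<alpha> i * A i x) = l x" for x
    unfolding l_def A_def sum_3 by (simp add: algebra_simps)
  obtain d where d: "hilbert_function I d = s" "2 \<le> d"
    using s unfolding eventually_sequentially by (meson max.cobounded1 max.cobounded2)
  define W where "W v i x = (\<Sum>j\<in>UNIV. v i j * B j x)" for v :: "3 \<Rightarrow> 3 \<Rightarrow> complex" and i x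
  define D where "D v i x = l x * W v i x - A i x * (\<Sum>i'\<in>UNIV. \<alpha> i' * W v i' x)" for v i x
  \<comment> \<open>The factor \<open>l ^ (d - 2)\<close> lifts the quadrics \<open>D v i\<close> to the degree \<open>d\<close> in which the Hilbert
    function is known; \<open>h i (i', j)\<close> is the coefficient of \<open>v i' j\<close> in this lift.\<close>
  define h where "h i = (\<lambda>(i', j) x. l x ^ (d - 2) *
      ((if i' = i then 1 else 0) * (l x * B j x) - \<alpha> i' * (A i x * B j x)))" for i
  have form_h: "form d (h i m)" for i m
  proof -
    obtain i' j where m: "m = (i', j)" by fastforce
    have "form (d - 2 + (1 + 1)) (h i m)"
      unfolding h_def m prod.case
      by (intro form_mult form_diff form_cmult form_1_power form_l form_A form_B)
    moreover have "d - 2 + (1 + 1) = d" using d(2) by simp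
    ultimately show ?thesis by (simp only:)
  qed
  have sum_h: "(\<Sum>m\<in>UNIV. c m * h i m x) = l x ^ (d - 2) * D (\<lambda>i j. c (i, j)) i x" for c i x
  proof -
    have "(\<Sum>m\<in>UNIV. c m * h i m x) = (\<Sum>i'\<in>UNIV. \<Sum>j\<in>UNIV. c (i', j) * h i (i', j) x)"
      by (simp add: sum.cartesian_product flip: UNIV_Times_UNIV)
    also have "\<dots> = l x ^ (d - 2) * D (\<lambda>i j. c (i, j)) i x"
      unfolding sum_3 D_def W_def h_def
      using exhaust_3[of i] by (elim disjE) (simp_all add: algebra_simps)
    finally show ?thesis .
  qed
  obtain c where c: "\<exists>m\<in>UNIV. c m \<noteq> 0"
    "\<And>i. i \<in> {2, 3} \<Longrightarrow> (\<lambda>x. \<Sum>m\<in>UNIV. c m * h i m x) \<in> I"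
  proof (rule nontrivial_combination_in_ideal[OF I(1) d(1), of "{2, 3 :: 3}" "UNIV :: (3 \<times> 3) set" h])
    show "card {2, 3 :: 3} * s < card (UNIV :: (3 \<times> 3) set)" using sch(2) by simp
  qed (use form_h in auto)
  define v where "v i j = c (i, j)" for i j
  have v0: "\<exists>i j. v i j \<noteq> 0" using c(1) by (auto simp: v_def)
  have poly_W: "polynomial_fun (W v i)" and poly_D: "polynomial_fun (D v i)" for i
    unfolding D_def W_def by (intro polynomial_fun_intros poly_form)+
  have D23: "D v i \<in> I" if "i \<in> {2, 3}" for i
  proof -
    have "(\<lambda>x. l x ^ (d - 2) * D v i x) \<in> I"
      using c(2)[OF that] unfolding sum_h v_def .
    with nzd poly_form(1) poly_D show ?thesis by (rule nonzerodivisor_power)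
  qed
  \<comment> \<open>The condition for \<open>i = 1\<close> follows from the other two, because \<open>\<alpha> 1 = 1\<close>.\<close>
  have D1: "D v 1 = (\<lambda>x. (- \<alpha> 2) * D v 2 x + (- \<alpha> 3) * D v 3 x)"
  proof
    fix x
    have "(\<Sum>i\<in>UNIV. \<alpha> i * D v i x) = l x * (\<Sum>i\<in>UNIV. \<alpha> i * W v i x)
        - (\<Sum>i\<in>UNIV. \<alpha> i * A i x) * (\<Sum>i\<in>UNIV. \<alpha> i * W v i x)"
      by (simp add: D_def sum_3 algebra_simps)
    then have "(\<Sum>i\<in>UNIV. \<alpha> i * D v i x) = 0" by (simp add: sum_A)
    then show "D v 1 x = (- \<alpha> 2) * D v 2 x + (- \<alpha> 3) * D v 3 x"
      by (simp add: sum_3 \<alpha>(1) algebra_simps eq_neg_iff_add_eq_0)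
  qed
  have "D v 1 \<in> I"
    unfolding D1 by (intro ideal_add ideal_cmult I(1) D23) auto
  with D23 have D: "D v i \<in> I" for i
    using exhaust_3[of i] by auto
  define L where "L i i' k x = (\<Sum>j\<in>UNIV. v i' j * U i j k x) - (\<Sum>j\<in>UNIV. v i j * U i' j k x)" for i i' k x
  have form_L: "form 1 (L i i' k)" for i i' k
    unfolding L_def by (intro form_diff form_sum form_cmult U)
  have L: "L i i' k \<in> I" for i i' k
  proof -
    \<comment> \<open>On the Segre variety, eliminating \<open>W v\<close> by means of \<open>D v\<close> expresses \<open>l\<^sup>3 L\<close> through \<open>D v\<close>.\<close>
    let ?N = "\<lambda>x. C k x * (A i x * D v i' x - A i' x * D v i x)"
    have "(\<lambda>x. l x ^ 3 * L i i' k x - ?N x) \<in> vanishing_ideal X"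
      unfolding vanishing_ideal_def
    proof (intro CollectI conjI ballI)
      show "polynomial_fun (\<lambda>x. l x ^ 3 * L i i' k x - ?N x)"
        by (intro polynomial_fun_intros poly_form poly_D form_imp_polynomial_fun[OF form_L])
      fix q assume "q \<in> X"
      then obtain x y z where q: "\<And>i j k. U i j k q = x i * y j * z k" using X by blast
      define a where "a = (\<Sum>i\<in>UNIV. \<alpha> i * x i)"
      define b where "b = (\<Sum>j\<in>UNIV. \<beta> j * y j)"
      define e where "e = (\<Sum>k\<in>UNIV. \<gamma> k * z k)"
      define w where "w i = (\<Sum>j\<in>UNIV. v i j * y j)" for i
      have 1: "l q = a * b * e" "A i q = x i * b * e" "B j q = y j * a * e" "C k q = z k * a * b" for i j k
        unfolding l_def A_def B_def C_def q a_def b_def e_def sum_3 by (simp_all add: algebra_simps)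
      have 2: "W v i q = a * e * w i" for i
        unfolding W_def 1 w_def sum_3 by (simp add: algebra_simps)
      define u where "u = (\<Sum>i\<in>UNIV. \<alpha> i * w i)"
      have 3: "(\<Sum>i\<in>UNIV. \<alpha> i * W v i q) = a * e * u"
        unfolding 2 u_def sum_3 by (simp add: algebra_simps)
      have 4: "L i i' k q = z k * (x i * w i' - x i' * w i)"
        unfolding L_def q w_def sum_3 by (simp add: algebra_simps)
      show "l q ^ 3 * L i i' k q - ?N q = 0"
        unfolding D_def 3 4 1 2 by (simp add: algebra_simps power3_eq_cube)
    qed
    then have "(\<lambda>x. l x ^ 3 * L i i' k x - ?N x) \<in> I" using XI by blast
    moreover have "?N \<in> I" by (intro ideal_mult ideal_diff I(1) D poly_form)
    ultimately have "(\<lambda>x. (l x ^ 3 * L i i' k x - ?N x) + ?N x) \<in> I" by (rule ideal_add[OF I(1)])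
    then have "(\<lambda>x. l x ^ 3 * L i i' k x) \<in> I" by simp
    with nzd poly_form(1) form_imp_polynomial_fun[OF form_L] show ?thesis
      by (rule nonzerodivisor_power)
  qed
  show thesis
  proof (rule that[OF v0])
    fix i i' k
    have "L i i' k p = 0" by (rule linear_form_vanishes_on_scheme_span[OF I(1) form_L L p])
    then show "(\<Sum>j\<in>UNIV. U i j k p * v i' j) = (\<Sum>j\<in>UNIV. U i' j k p * v i j)"
      by (simp add: L_def mult.commute)
  qed
qed

definition succ3 :: "3 \<Rightarrow> 3" where
  "succ3 m = (if m = 1 then 2 else if m = 2 then 3 else 1)"

lemma det_eq_0_iff_kernel:
  fixes A :: "complex ^ 'n ^ 'n"
  shows "det A = 0 \<longleftrightarrow> (\<exists>w. A *v w = 0 \<and> w \<noteq> 0)"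
proof -
  have "det A \<noteq> 0 \<longleftrightarrow> (\<exists>B :: complex ^ 'n ^ 'n. B ** A = mat 1)"
    by (simp only: invertible_det_nz[symmetric] invertible_left_inverse)
  also have "\<dots> \<longleftrightarrow> (\<forall>w. A *v w = 0 \<longrightarrow> w = 0)"
    by (rule matrix_left_invertible_ker)
  finally show ?thesis by blast
qed

text \<open>The block matrix with rows \<open>(0, -t\<^sub>3, t\<^sub>2)\<close>, \<open>(t\<^sub>3, 0, -t\<^sub>1)\<close>, \<open>(-t\<^sub>2, t\<^sub>1, 0)\<close>, where the blocks \<open>t\<^sub>i\<close>
  are the transposed slices of the tensor. It represents the map from \<open>A \<otimes> B*\<close> to \<open>\<Lambda>\<^sup>2 A \<otimes> C\<close>; the wedge
  of the basis vectors other than the \<open>m\<close>-th one is indexed by \<open>m\<close>. On tensors of rank one it has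
  rank two, and its determinant is, up to a scalar, Strassen's equation of degree nine.\<close>

definition koszul :: "(3 \<Rightarrow> 3 \<Rightarrow> 3 \<Rightarrow> complex) \<Rightarrow> complex ^ (3 \<times> 3) ^ (3 \<times> 3)" where
  "koszul t = (\<chi> mk ij.
     if fst ij = succ3 (succ3 (fst mk)) then t (succ3 (fst mk)) (snd ij) (snd mk)
     else if fst ij = succ3 (fst mk) then - t (succ3 (succ3 (fst mk))) (snd ij) (snd mk) else 0)"

lemma koszul_mult:
  "(koszul t *v w) $ (m, k) =
     (\<Sum>j\<in>UNIV. t (succ3 m) j k * w $ (succ3 (succ3 m), j)) -
     (\<Sum>j\<in>UNIV. t (succ3 (succ3 m)) j k * w $ (succ3 m, j))"
proof -
  have "(koszul t *v w) $ (m, k) = (\<Sum>i\<in>UNIV. \<Sum>j\<in>UNIV. koszul t $ (m, k) $ (i, j) * w $ (i, j))"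
    by (simp add: matrix_vector_mult_def sum.cartesian_product flip: UNIV_Times_UNIV)
  also have "\<dots> = (\<Sum>j\<in>UNIV. t (succ3 m) j k * w $ (succ3 (succ3 m), j)) -
     (\<Sum>j\<in>UNIV. t (succ3 (succ3 m)) j k * w $ (succ3 m, j))"
    using exhaust_3[of m] by (elim disjE) (simp_all add: koszul_def succ3_def sum_3)
  finally show ?thesis .
qed

lemma form_det_koszul:
  assumes "\<And>i j k. form 1 (U i j k)"
  shows "form 9 (\<lambda>p. det (koszul (\<lambda>i j k. U i j k p)))"
proof -
  have entry: "form 1 (\<lambda>p. koszul (\<lambda>i j k. U i j k p) $ m $ n)" for m n
    unfolding koszul_def vec_lambda_beta
    using assms form_cmult[OF assms, of "-1"] form_zero
    by (cases "fst n = succ3 (succ3 (fst m))"; cases "fst n = succ3 (fst m)") simp_all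
  have "form (sum (\<lambda>_. 1) (UNIV :: (3 \<times> 3) set)) (\<lambda>p. det (koszul (\<lambda>i j k. U i j k p)))"
    unfolding det_def by (intro form_sum form_cmult form_prod entry)
  then show ?thesis by simp
qed

lemma det_koszul_eq_0:
  fixes U :: "3 \<Rightarrow> 3 \<Rightarrow> 3 \<Rightarrow> complex ^ 'n \<Rightarrow> complex"
  assumes U: "\<And>i j k. form 1 (U i j k)"
    and X: "\<And>q. q \<in> X \<Longrightarrow> \<exists>x y z. \<forall>i j k. U i j k q = x i * y j * z k"
    and nondeg: "\<And>q. q \<noteq> 0 \<Longrightarrow> \<exists>i j k. U i j k q \<noteq> 0"
    and p: "cactus_rank X p \<le> enat 4"
  shows "det (koszul (\<lambda>i j k. U i j k p)) = 0"
proof -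
  obtain I s where I: "s \<le> 4" "zero_dim_subscheme I s" "vanishing_ideal X \<subseteq> I" "p \<in> scheme_span I"
    using cactus_rank_witness[OF p] .
  show ?thesis
  proof (rule koszul_kernel[OF I(2,1,3,4) U X nondeg])
    fix v :: "3 \<Rightarrow> 3 \<Rightarrow> complex"
    assume v: "\<exists>i j. v i j \<noteq> 0"
      "\<And>i i' k. (\<Sum>j\<in>UNIV. U i j k p * v i' j) = (\<Sum>j\<in>UNIV. U i' j k p * v i j)"
    let ?w = "\<chi> ij. v (fst ij) (snd ij)"
    have "(koszul (\<lambda>i j k. U i j k p) *v ?w) $ (m, k) = 0" for m k
      unfolding koszul_mult using v(2)[of "succ3 m" k "succ3 (succ3 m)"] by simp
    then have "koszul (\<lambda>i j k. U i j k p) *v ?w = 0"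
      by (simp add: vec_eq_iff split_paired_all)
    moreover have "?w \<noteq> 0" using v(1) by (auto simp: vec_eq_iff)
    ultimately show ?thesis unfolding det_eq_0_iff_kernel by blast
  qed
qed

section \<open>The tensor in coordinates\<close>

definition lincomb3 :: "(nat \<Rightarrow> complex ^ 3) \<Rightarrow> complex \<Rightarrow> complex \<Rightarrow> complex \<Rightarrow> complex ^ 3" where
  "lincomb3 e x y z = x *s e 1 + y *s e 2 + z *s e 3"

text \<open>The rows of \<open>M\<close> are the dual basis.\<close>

lemma basis3_dual:
  assumes "basis3 e"
  shows "\<exists>M :: complex ^ 3 ^ 3.
    (\<forall>x y z. M *v lincomb3 e x y z = (\<chi> i. if i = 1 then x else if i = 2 then y else z)) \<and>
    (\<forall>v. M *v v = 0 \<longrightarrow> v = 0)"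
proof -
  define A :: "complex ^ 3 ^ 3" where "A = (\<chi> r i. e (if i = 1 then 1 else if i = 2 then 2 else 3) $ r)"
  have A: "A *v (\<chi> i. if i = 1 then x else if i = 2 then y else z) = lincomb3 e x y z" for x y z
    by (simp add: vec_eq_iff A_def lincomb3_def matrix_vector_mult_def sum_3 mult.commute)
  have "{1..3} = {1, 2, 3 :: nat}" by auto
  then have "e ` {1..3} \<subseteq> columns A"
    by (auto simp: columns_def column_def A_def intro: exI[of _ 1] exI[of _ 2] exI[of _ 3])
  then have "vec.span (columns A) = UNIV"
    using assms vec.span_mono unfolding basis3_def by blast
  then obtain M where "A ** M = mat 1"
    using matrix_right_invertible_span_columns by blast
  then have M: "M ** A = mat 1" "A ** M = mat 1" using matrix_left_right_inverse by blast+
  show ?thesis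
  proof (intro exI[of _ M] conjI allI impI)
    show "M *v lincomb3 e x y z = (\<chi> i. if i = 1 then x else if i = 2 then y else z)" for x y z
      unfolding A[symmetric] by (simp add: matrix_vector_mul_assoc M)
    fix v assume v: "M *v v = 0"
    have "v = A *v (M *v v)" by (simp add: matrix_vector_mul_assoc M)
    then show "v = 0" by (simp add: v)
  qed
qed

lemma lincomb3_eq_0:
  assumes "basis3 e" and "lincomb3 e x y z = 0"
  shows "x = 0 \<and> y = 0 \<and> z = 0"
proof -
  obtain M :: "complex ^ 3 ^ 3" where M:
    "\<And>x y z. M *v lincomb3 e x y z = (\<chi> i. if i = 1 then x else if i = 2 then y else z)"
    using basis3_dual[OF assms(1)] by metis
  have "(\<chi> i::3. if i = 1 then x else if i = 2 then y else z) = 0"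
    using M[of x y z] assms(2) by simp
  then show ?thesis by (simp add: vec_eq_iff forall_3)
qed

text \<open>With dual bases for the matrices, these are the coordinates with respect to the given bases. The
  lower bound is proved for the coordinates as functions on the original space, so no
  subscheme is transported along a change of bases.\<close>

definition tensor_coordinate :: "complex ^ 3 ^ 3 \<Rightarrow> complex ^ 3 ^ 3 \<Rightarrow> complex ^ 3 ^ 3 \<Rightarrow>
    3 \<Rightarrow> 3 \<Rightarrow> 3 \<Rightarrow> complex ^ (3 \<times> 3 \<times> 3) \<Rightarrow> complex" where
  "tensor_coordinate M N K i j k p =
     (\<Sum>r\<in>UNIV. M $ i $ r * (\<Sum>s\<in>UNIV. N $ j $ s * (\<Sum>t\<in>UNIV. K $ k $ t * p $ (r, s, t))))"

lemma form_tensor_coordinate: "form 1 (tensor_coordinate M N K i j k)"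
  unfolding tensor_coordinate_def by (intro form_sum form_cmult form_coord)

lemma tensor_coordinate_tensor:
  "tensor_coordinate M N K i j k (x \<otimes> y \<otimes> z) = (M *v x) $ i * (N *v y) $ j * (K *v z) $ k"
proof -
  have *: "(\<Sum>r\<in>UNIV. H $ l $ r * (d * v $ r)) = d * (H *v v) $ l"
    for H :: "complex ^ 3 ^ 3" and l d v
    by (simp add: matrix_vector_mult_def sum_distrib_left mult.left_commute)
  have "(\<Sum>t\<in>UNIV. K $ k $ t * (x \<otimes> y \<otimes> z) $ (r, s, t)) = (x $ r * (K *v z) $ k) * y $ s" for r s
    using *[of K k "x $ r * y $ s" z] by (simp add: tensor_def mult_ac)
  moreover have "(x $ r * (K *v z) $ k) * (N *v y) $ j = ((K *v z) $ k * (N *v y) $ j) * x $ r" for r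
    by simp
  ultimately show ?thesis
    unfolding tensor_coordinate_def by (simp only: *) simp
qed

lemma tensor_coordinate_nondegenerate:
  assumes M: "\<And>v. M *v v = 0 \<Longrightarrow> v = 0" and N: "\<And>v. N *v v = 0 \<Longrightarrow> v = 0"
    and K: "\<And>v. K *v v = 0 \<Longrightarrow> v = 0" and p: "\<And>i j k. tensor_coordinate M N K i j k p = 0"
  shows "p = 0"
proof -
  have ker: "f r = 0" if "\<And>v. H *v v = 0 \<Longrightarrow> v = 0" "\<And>i. (\<Sum>r\<in>UNIV. H $ i $ r * f r) = 0"
    for H :: "complex ^ 3 ^ 3" and f r
  proof -
    have "H *v (\<chi> r. f r) = 0"
      using that(2) by (simp add: vec_eq_iff matrix_vector_mult_def)
    then have "(\<chi> r. f r) = 0" by (rule that(1))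
    then show ?thesis by (simp add: vec_eq_iff)
  qed
  have 1: "(\<Sum>s\<in>UNIV. N $ j $ s * (\<Sum>t\<in>UNIV. K $ k $ t * p $ (r, s, t))) = 0" for r j k
    by (rule ker[OF M]) (use p in \<open>simp_all add: tensor_coordinate_def\<close>)
  have 2: "(\<Sum>t\<in>UNIV. K $ k $ t * p $ (r, s, t)) = 0" for r s k
    by (rule ker[where H = N and f = "\<lambda>s. \<Sum>t\<in>UNIV. K $ k $ t * p $ (r, s, t)"])
      (auto intro: N 1)
  have "p $ (r, s, t) = 0" for r s t
    by (rule ker[where H = K and f = "\<lambda>t. p $ (r, s, t)"]) (auto intro: K 2)
  then show ?thesis by (simp add: vec_eq_iff split_paired_all)
qed

lemma tensor_linear:
  "(x + x') \<otimes> y = x \<otimes> y + x' \<otimes> y" "x \<otimes> (y + y') = x \<otimes> y + x \<otimes> y'"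
  "(k *s x) \<otimes> y = k *s (x \<otimes> y)" "x \<otimes> (k *s y) = k *s (x \<otimes> y)"
  by (simp_all add: tensor_def vec_eq_iff algebra_simps)

lemma tensor_zero: "0 \<otimes> y = 0" "x \<otimes> 0 = 0"
  by (simp_all add: tensor_def vec_eq_iff)

lemma tensor_eq_0: "x \<otimes> y = 0 \<longleftrightarrow> x = 0 \<or> y = 0"
  by (auto simp: tensor_def vec_eq_iff)

lemma tensor_in_span:
  assumes "x \<in> vec.span A" and "y \<in> vec.span B"
  shows "x \<otimes> y \<in> vec.span ((\<lambda>(x, y). x \<otimes> y) ` (A \<times> B))"
proof -
  let ?S = "vec.span ((\<lambda>(x, y). x \<otimes> y) ` (A \<times> B))"
  have *: "u \<otimes> y \<in> ?S" if u: "u \<in> A" for u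
    using assms(2)
  proof (induction rule: vec.span_induct_alt)
    case base
    then show ?case by (simp add: tensor_zero vec.span_zero)
  next
    case (step c v w)
    have "u \<otimes> v \<in> ?S" using u step(1) by (intro vec.span_base) auto
    with step(2) show ?case
      by (simp add: tensor_linear vec.span_add vec.span_scale)
  qed
  show ?thesis
    using assms(1)
  proof (induction rule: vec.span_induct_alt)
    case base
    then show ?case by (simp add: tensor_zero vec.span_zero)
  next
    case (step c v w)
    with * show ?case
      by (simp add: tensor_linear vec.span_add vec.span_scale)
  qed
qed

lemma segre3_scale: "p \<in> segre3 \<Longrightarrow> t \<noteq> 0 \<Longrightarrow> t *s p \<in> segre3"
  unfolding segre3_def by (clarsimp simp flip: tensor_linear(3)) (metis vec.scale_eq_0_iff)

lemma segre6_eq: "segre6 = (\<lambda>(p, q). p \<otimes> q) ` (segre3 \<times> segre3)"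
  unfolding segre6_def segre3_def by (auto simp: image_iff) blast+

lemma tensor_in_segre6: "p \<in> segre3 \<Longrightarrow> q \<in> segre3 \<Longrightarrow> p \<otimes> q \<in> segre6"
  unfolding segre6_eq by (rule image_eqI[of _ _ "(p, q)"]) auto

lemma segre6_scale:
  assumes "p \<in> segre6" and "t \<noteq> 0"
  shows "t *s p \<in> segre6"
proof -
  obtain u v where "u \<in> segre3" "v \<in> segre3" "p = u \<otimes> v"
    using assms(1) unfolding segre6_eq by auto
  then show ?thesis
    using tensor_in_segre6[OF segre3_scale[OF _ assms(2)]] by (simp add: tensor_linear)
qed

lemma card_four: "card {a, b, c, d} \<le> 4"
  by (simp add: card_insert_if)

text \<open>The hypothesis lists the coordinates of the tensor of the theorem. The entries of a vector \<open>w\<close>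
  are recovered from its image by the inverse matrix. More generally, with \<open>\<lambda>\<close> in place of the
  coefficient \<open>2\<close>, the determinant is \<open>2 \<lambda> (\<lambda> - 1)\<close>.\<close>

lemma det_koszul_nonzero:
  assumes t: "\<And>i j k. t i j k = (if i = j \<and> j = k then 1 else 0) + 1 +
    (if i \<noteq> 3 \<and> j \<noteq> 2 \<and> k \<noteq> (1::3) then 2 else 0)"
  shows "det (koszul t) \<noteq> 0"
proof -
  have "w = 0" if w: "koszul t *v w = 0" for w
  proof -
    let ?E = "\<lambda>m k. (koszul t *v w) $ (m, k)"
    have "w $ (1, 1) = -9/4 * ?E 1 1 + 3/2 * ?E 1 2 + 1/2 * ?E 1 3 + 9/4 * ?E 2 2 + -1 * ?E 2 3 + -1/2 * ?E 3 1 + 3/2 * ?E 3 2 + -5/4 * ?E 3 3"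
      "w $ (1, 2) = -1 * ?E 3 2 + 1 * ?E 3 3"
      "w $ (1, 3) = -1 * ?E 2 2 + 1 * ?E 2 3"
      "w $ (2, 1) = -3/2 * ?E 1 1 + 1 * ?E 1 2 + 1 * ?E 1 3 + 3/2 * ?E 2 2 + 1 * ?E 3 2 + -1/2 * ?E 3 3"
      "w $ (2, 2) = 9/4 * ?E 1 1 + -3/2 * ?E 1 2 + -3/2 * ?E 1 3 + -9/4 * ?E 2 2 + 3/2 * ?E 3 1 + -5/2 * ?E 3 2 + 5/4 * ?E 3 3"
      "w $ (2, 3) = -3/2 * ?E 1 1 + 1 * ?E 1 2 + 1/2 * ?E 2 2 + -1 * ?E 3 1 + 1 * ?E 3 2 + -1/2 * ?E 3 3"
      "w $ (3, 1) = -5/2 * ?E 1 1 + 1 * ?E 1 2 + 1 * ?E 1 3 + -1 * ?E 2 1 + 3/2 * ?E 2 2 + -1 * ?E 3 1 + 1 * ?E 3 2 + -1/2 * ?E 3 3"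
      "w $ (3, 2) = 3/2 * ?E 1 1 + -1 * ?E 1 3 + -1/2 * ?E 2 2 + 1 * ?E 3 1 + -1 * ?E 3 2 + 1/2 * ?E 3 3"
      "w $ (3, 3) = 5/4 * ?E 1 1 + -1/2 * ?E 1 2 + -1/2 * ?E 1 3 + 1 * ?E 2 1 + -5/4 * ?E 2 2 + 1/2 * ?E 3 1 + -1/2 * ?E 3 2 + 1/4 * ?E 3 3"
      unfolding koszul_mult sum_3 t succ3_def by (simp_all add: field_simps)
    then show ?thesis
      unfolding w by (simp add: vec_eq_iff split_paired_all forall_3)
  qed
  then show ?thesis unfolding det_eq_0_iff_kernel by blast
qed

theorem mainTheorem6:
  fixes a b c :: "nat \<Rightarrow> complex ^ 3"
    and T :: "complex ^ (3 \<times> 3 \<times> 3)"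
  assumes "basis3 a" and "basis3 b" and "basis3 c"
    and "T = a 1 \<otimes> b 1 \<otimes> c 1 + a 2 \<otimes> b 2 \<otimes> c 2 + a 3 \<otimes> b 3 \<otimes> c 3
           + (\<Sum>i=1..3. a i) \<otimes> (\<Sum>i=1..3. b i) \<otimes> (\<Sum>i=1..3. c i)
           + 2 *s ((a 1 + a 2) \<otimes> (b 1 + b 3) \<otimes> (c 2 + c 3))"
  shows "cactus_border_rank segre3 T = 5
       \<and> cactus_border_rank segre6 (T \<otimes> T) \<le> 24
       \<and> cactus_rank segre6 (T \<otimes> T) < (cactus_rank segre3 T)^2
       \<and> cactus_border_rank segre6 (T \<otimes> T) < (cactus_border_rank segre3 T)^2"
proof -
  define R where "R x1 x2 x3 y1 y2 y3 z1 z2 z3 =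
    lincomb3 a x1 x2 x3 \<otimes> lincomb3 b y1 y2 y3 \<otimes> lincomb3 c z1 z2 z3" for x1 x2 x3 y1 y2 y3 z1 z2 z3
  define Z where "Z = R 1 1 0 1 0 1 0 1 1"
  \<comment> \<open>\<open>S\<close> and \<open>S'\<close> contain the terms of the decompositions of \<open>Q\<close> and of \<open>4 (Q + Z)\<close>.\<close>
  define S where "S = {R 1 0 0 1 0 0 1 0 0, R 0 1 0 0 1 0 0 1 0, R 0 0 1 0 0 1 0 0 1, R 1 1 1 1 1 1 1 1 1}"
  define S' where "S' = {R 2 2 1 2 1 2 1 2 2, R 0 2 1 0 1 0 1 2 0, R 2 0 1 2 1 0 1 0 0, R 0 0 1 0 1 2 1 0 2}"
  define Q where "Q = R 1 0 0 1 0 0 1 0 0 + R 0 1 0 0 1 0 0 1 0 + R 0 0 1 0 0 1 0 0 1 + R 1 1 1 1 1 1 1 1 1"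
  have sums: "(\<Sum>i=1..3. e i) = e 1 + e 2 + e (3::nat)" for e :: "nat \<Rightarrow> complex ^ 3"
  proof -
    have "{1..3} = {1, 2, 3 :: nat}" by auto
    then show ?thesis by (simp add: add.assoc)
  qed
  have T: "T = Q + 2 *s Z"
    unfolding assms(4) Q_def Z_def R_def lincomb3_def sums by simp
  have Q': "Q + Z = (1/4) *s (R 2 2 1 2 1 2 1 2 2 + R 0 2 1 0 1 0 1 2 0 + R 2 0 1 2 1 0 1 0 0 + R 0 0 1 0 1 2 1 0 2)"
    unfolding Q_def Z_def R_def lincomb3_def by (simp add: vec_eq_iff tensor_def field_simps)
  have R_segre: "R x1 x2 x3 y1 y2 y3 z1 z2 z3 \<in> segre3"
    if "x1 \<noteq> 0 \<or> x2 \<noteq> 0 \<or> x3 \<noteq> 0" "y1 \<noteq> 0 \<or> y2 \<noteq> 0 \<or> y3 \<noteq> 0" "z1 \<noteq> 0 \<or> z2 \<noteq> 0 \<or> z3 \<noteq> 0"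
    for x1 x2 x3 y1 y2 y3 z1 z2 z3
    using that lincomb3_eq_0 assms(1-3) unfolding R_def segre3_def by blast
  have Z: "Z \<in> segre3" and S: "S \<subseteq> segre3" and S': "S' \<subseteq> segre3"
    unfolding Z_def S_def S'_def by (auto intro!: R_segre)
  have fin: "finite S" "finite S'" and card: "card S \<le> 4" "card S' \<le> 4"
    unfolding S_def S'_def using card_four by auto
  have QS: "Q \<in> vec.span S"
    unfolding Q_def S_def by (intro vec.span_add vec.span_base) auto
  have QS': "Q + Z \<in> vec.span S'"
    unfolding Q' S'_def by (intro vec.span_scale vec.span_add vec.span_base) auto

  have upper3: "cactus_rank segre3 T \<le> enat 5"
  proof -
    have "T \<in> vec.span (insert Z S)"
      unfolding T using QS vec.span_mono[of S "insert Z S"]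
      by (intro vec.span_add vec.span_scale) (auto intro: vec.span_base)
    then have "cactus_rank segre3 T \<le> card (insert Z S)"
      using fin Z S by (intro cactus_rank_le_card) (auto intro: segre3_scale)
    also have "card (insert Z S) \<le> 5"
      using card_insert_le_m1[of 5 S Z] card by simp
    finally show ?thesis by simp
  qed

  have upper6: "cactus_rank segre6 (T \<otimes> T) \<le> enat 24"
  proof -
    let ?f = "\<lambda>(x, y). x \<otimes> y"
    let ?P = "?f ` (S \<times> S)" and ?P' = "?f ` (S' \<times> {Z})" and ?P'' = "?f ` ({Z} \<times> S')"
    let ?W = "?P \<union> ?P' \<union> ?P''"
    have "Q \<otimes> Q \<in> vec.span ?W" "(Q + Z) \<otimes> Z \<in> vec.span ?W" "Z \<otimes> (Q + Z) \<in> vec.span ?W"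
      using tensor_in_span[OF QS QS] tensor_in_span[OF QS' vec.span_base[of Z "{Z}"]]
        tensor_in_span[OF vec.span_base[of Z "{Z}"] QS']
        vec.span_mono[of ?P ?W] vec.span_mono[of ?P' ?W] vec.span_mono[of ?P'' ?W] by blast+
    then have "Q \<otimes> Q + 2 *s ((Q + Z) \<otimes> Z) + 2 *s (Z \<otimes> (Q + Z)) \<in> vec.span ?W"
      by (intro vec.span_add vec.span_scale)
    also have "Q \<otimes> Q + 2 *s ((Q + Z) \<otimes> Z) + 2 *s (Z \<otimes> (Q + Z)) = T \<otimes> T"
      unfolding T by (simp add: tensor_def vec_eq_iff algebra_simps)
    finally have "cactus_rank segre6 (T \<otimes> T) \<le> card ?W"
      using fin Z S S' by (intro cactus_rank_le_card) (auto intro: segre6_scale tensor_in_segre6)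
    also have "card ?W \<le> 24"
    proof -
      have "card ?P \<le> card (S \<times> S)" "card ?P' \<le> card (S' \<times> {Z})" "card ?P'' \<le> card ({Z} \<times> S')"
        using fin by (intro card_image_le; simp)+
      moreover have "card S * card S \<le> 4 * 4" using card by (intro mult_le_mono)
      ultimately have "card ?P \<le> 16" "card ?P' \<le> 4" "card ?P'' \<le> 4"
        using card by (auto simp: card_cartesian_product)
      then show ?thesis
        using card_Un_le[of "?P \<union> ?P'" ?P''] card_Un_le[of ?P ?P'] by linarith
    qed
    finally show ?thesis by simp
  qed

  obtain A :: "complex ^ 3 ^ 3" where A: "\<And>x y z. A *v lincomb3 a x y z = (\<chi> i. if i = 1 then x else if i = 2 then y else z)"
    "\<And>v. A *v v = 0 \<Longrightarrow> v = 0"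
    using basis3_dual[OF assms(1)] by auto
  obtain B :: "complex ^ 3 ^ 3" where B: "\<And>x y z. B *v lincomb3 b x y z = (\<chi> i. if i = 1 then x else if i = 2 then y else z)"
    "\<And>v. B *v v = 0 \<Longrightarrow> v = 0"
    using basis3_dual[OF assms(2)] by auto
  obtain C :: "complex ^ 3 ^ 3" where C: "\<And>x y z. C *v lincomb3 c x y z = (\<chi> i. if i = 1 then x else if i = 2 then y else z)"
    "\<And>v. C *v v = 0 \<Longrightarrow> v = 0"
    using basis3_dual[OF assms(3)] by auto
  let ?U = "tensor_coordinate A B C"
  have U_add: "?U i j k (p + q) = ?U i j k p + ?U i j k q" for i j k p q
    by (rule form_1_additive[OF form_tensor_coordinate])
  have U_scale: "?U i j k (t *s p) = t * ?U i j k p" for i j k t p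
    using form_scale[OF form_tensor_coordinate] by simp
  have "?U i j k T = (if i = j \<and> j = k then 1 else 0) + 1 + (if i \<noteq> 3 \<and> j \<noteq> 2 \<and> k \<noteq> 1 then 2 else 0)" for i j k
    unfolding T Q_def Z_def R_def U_add U_scale tensor_coordinate_tensor A(1) B(1) C(1)
    using exhaust_3[of i] exhaust_3[of j] exhaust_3[of k] by (elim disjE) simp_all
  then have det: "det (koszul (\<lambda>i j k. ?U i j k T)) \<noteq> 0"
    by (rule det_koszul_nonzero)
  let ?F = "\<lambda>p. det (koszul (\<lambda>i j k. ?U i j k p))"
  have F: "form 9 ?F" by (rule form_det_koszul[OF form_tensor_coordinate])
  have "?F q = 0" if "cactus_rank segre3 q \<le> enat 4" for q
  proof (rule det_koszul_eq_0[OF form_tensor_coordinate _ _ that])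
    show "\<exists>x y z. \<forall>i j k. ?U i j k q = x i * y j * z k" if "q \<in> segre3" for q
      using that unfolding segre3_def by (force simp: tensor_coordinate_tensor)
    show "\<exists>i j k. ?U i j k q \<noteq> 0" if "q \<noteq> 0" for q
      using tensor_coordinate_nondegenerate[OF A(2) B(2) C(2)] that by blast
  qed
  then have "cactus_border_rank segre3 T \<ge> enat (Suc 4)"
    using F det by (intro cactus_border_rank_geI)
  then have lower3: "cactus_border_rank segre3 T \<ge> 5"
    by (simp add: numeral_eq_enat)

  have T0: "T \<noteq> 0"
  proof
    assume "T = 0"
    then show False using form_scale[OF F, of 0 0] det by simp
  qed
  then have TT0: "T \<otimes> T \<noteq> 0" by (simp add: tensor_eq_0)
  have "cactus_border_rank segre3 T \<le> cactus_rank segre3 T"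
    using T0 by (rule cactus_border_rank_le_cactus_rank)
  with upper3 lower3 have border3: "cactus_border_rank segre3 T = 5" and rank3: "5 \<le> cactus_rank segre3 T"
    by (auto simp: numeral_eq_enat)
  have border6: "cactus_border_rank segre6 (T \<otimes> T) \<le> cactus_rank segre6 (T \<otimes> T)"
    using TT0 by (rule cactus_border_rank_le_cactus_rank)
  have rank6: "cactus_rank segre6 (T \<otimes> T) \<le> 24"
    using upper6 by (simp add: numeral_eq_enat)
  have lt: "(24 :: enat) < 5 ^ 2" by (simp add: numeral_eq_enat power2_eq_square)
  have le: "(5 :: enat) ^ 2 \<le> cactus_rank segre3 T ^ 2"
    unfolding power2_eq_square using rank3 by (intro mult_mono) auto
  have border6_le: "cactus_border_rank segre6 (T \<otimes> T) \<le> 24"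
    using border6 rank6 by (rule order.trans)
  show ?thesis
    unfolding border3
    using border6_le order.strict_trans1[OF rank6 order.strict_trans2[OF lt le]]
      order.strict_trans1[OF border6_le lt] by blast
qed

end
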